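(* Suppose that there exists a vector in $\mathbb{R}^m\times\mathcal{W}\times\mathbb{R}^n\times\mathbb{R}^n$ satisfying the KKT system $$Qw^*-Qx^*=0,\quad Ax^*\in\partial\delta_{\mathcal{K}}^*(-y^* ),\quad x^*\in\partial\phi^*(-z^* ),\quad -Qw^*+A^*y^*+z^*-c=0,\qquad(\mathrm{KKT})$$ and let $u^*=(y^*,w^*,z^*,x^* )\in\mathbb{R}^m\times\mathcal{W}\times\mathbb{R}^n\times\mathbb{R}^n$ be a solution of (KKT). Let $\sigma>0$, let $\lambda_Q>0$ satisfy $\lambda_Q\ge\lambda_1(Q)$, let $\mathcal{S}_w=Q(\lambda_QI_n-Q)$, and let $\mathcal{S}_y$ be a self-adjoint positive semidefinite linear operator on $\mathbb{R}^m$ such that $\mathcal{S}_y+AA^*$ is positive definite. Let $\{\bar u_Q^k\}=\{(\bar y^k,\bar w_Q^k,\bar z^k,\bar x^k)\}$ and $\{u_Q^k\}=\{(y^k,w_Q^k,z^k,x^k)\}$ be the sequences generated by Algorithm B (defined in the context). Then, with $R_0=\|u_Q^0-u^*\|_{\mathcal{M}}$, for all $k\ge0$: $$\|\bar u_Q^{k+1}-u_Q^k\|_{\mathcal{M}}\le\frac{R_0}{k+1},$$ $$\|\mathcal{R}(\bar u_Q^{k+1})\|\le\left(\frac{\sigma\|A_Q^*\|+1}{\sqrt{\sigma}}+\left\|\sqrt{\mathcal{S}+\widehat{\mathcal{S}}_{\rm sGS}}\right\|\right)\frac{R_0}{k+1},$$ $$-\frac{\|x^*\|}{\sqrt{\sigma}}\cdot\frac{R_0}{k+1}\le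 h(\bar y^{k+1},\bar w_Q^{k+1},\bar z^{k+1})\le\left(3R_0+\frac{\|x^*\|}{\sqrt{\sigma}}\right)\frac{R_0}{k+1}.$$
   Context: Problem data: $Q:\mathbb{R}^n\to\mathbb{R}^n$ is a self-adjoint positive semidefinite linear operator, $\mathcal{W}:=\operatorname{Range}(Q)$, $c\in\mathbb{R}^n$, $\phi:\mathbb{R}^n\to(-\infty,+\infty]$ is proper, closed and convex, $A:\mathbb{R}^n\to\mathbb{R}^m$ is linear with adjoint $A^*$, and $\mathcal{K}=\{y\in\mathbb{R}^m\mid -\infty\le l_i\le y_i\le u_i\le+\infty,\ 1\le i\le m\}$. $\delta_{\mathcal{K}}$ is the indicator function of $\mathcal{K}$, $f^*$ denotes the convex conjugate of $f$, $\partial f$ the subdifferential, $\Pi_{\mathcal{K}}$ the Euclidean projection onto $\mathcal{K}$, $\operatorname{Prox}_\phi(x)=\arg\min_z\{\phi(z)+\tfrac12\|z-x\|^2\}$, $\lambda_1(\cdot)$ the largest eigenvalue of a self-adjoint operator, $I_n$ the identity, $\|\cdot\|$ the Euclidean norm or the spectral norm of an operator, and $\|x\|_{\mathcal{M}}=\sqrt{\langle x,\mathcal{M}x\rangle}$ for a self-adjoint positive semidefinite $\mathcal{M}$. Restricted Wolfe dual problem (D): $\min_{(y,w,z)\in\mathbb{R}^m\times\mathbb{R}^n\times\mathbb{R}^n}\{\tfrac12\langle w,Qw\rangle+\delta_{\mathcal{K}}^*(-y)+\phi^*(-z)\mid -Qw+A^*y+z=c,\ w\in\mathcal{W}\}$.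 If $(y^*,w^*,z^*,x^* )$ solves (KKT), then $(y^*,w^*,z^* )$ is an optimal solution of (D). Augmented Lagrangian: for $\sigma>0$, $$L_\sigma(y,w,z;x)=\tfrac12\langle w,Qw\rangle+\delta_{\mathcal{K}}^*(-y)+\phi^*(-z)+\langle x,-Qw+A^*y+z-c\rangle+\tfrac{\sigma}{2}\|-Qw+A^*y+z-c\|^2 .$$ Algorithm B. Write $u_Q=(y,w_Q,z,x)$, $\bar u_Q=(\bar y,\bar w_Q,\bar z,\bar x)$. Given $u_Q^0=(y^0,w_Q^0,z^0,x^0)\in\mathbb{R}^m\times\mathbb{R}^n\times\mathbb{R}^n\times\mathbb{R}^n$, for $k=0,1,2,\dots$: 1. $\bar z^{k+1}=\arg\min_{z\in\mathbb{R}^n}L_\sigma(y^k,w_Q^k,z;x^k)$; 2. $\bar x^{k+1}=x^k+\sigma(-Qw_Q^k+A^*y^k+\bar z^{k+1}-c)$; 3. $\bar w_Q^{k+1/2}=\frac{1}{1+\sigma\lambda_Q}\big(\sigma\lambda_Qw_Q^k+\bar x^{k+1}+\sigma(-Qw_Q^k+A^*y^k+\bar z^{k+1}-c)\big)$; 4. $\bar y^{k+1}=\arg\min_{y\in\mathbb{R}^m}\{L_\sigma(y,\bar w_Q^{k+1/2},\bar z^{k+1};\bar x^{k+1})+\tfrac{\sigma}{2}\|y-y^k\|_{\mathcal{S}_y}^2\}$; 5. $\bar w_Q^{k+1}=\frac{1}{1+\sigma\lambda_Q}\big(\sigma\lambda_Qw_Q^k+\bar x^{k+1}+\sigma(-Qw_Q^k+A^*\bar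 y^{k+1}+\bar z^{k+1}-c)\big)$; 6. $\hat u_Q^{k+1}=2\bar u_Q^{k+1}-u_Q^k$; 7. $u_Q^{k+1}=\tfrac{1}{k+2}u_Q^0+\tfrac{k+1}{k+2}\hat u_Q^{k+1}$. Operators: $A_Q:=[A^*\ \ -Q]$, i.e. $A_Q(y,w)=A^*y-Qw$, with adjoint $A_Q^*$; $$\mathcal{S}=\sigma\begin{pmatrix}\mathcal{S}_y&\mathbf 0\\ \mathbf 0&\mathcal{S}_w\end{pmatrix},\qquad \widehat{\mathcal{S}}_{\rm sGS}=\begin{pmatrix}\sigma^2AQ(\sigma Q^2+Q+\sigma\mathcal{S}_w)^{-1}QA^*&\mathbf 0\\ \mathbf 0&\mathbf 0\end{pmatrix},$$ acting on pairs $(y,w)$, where the inverse is that of $\sigma Q^2+Q+\sigma\mathcal{S}_w$ regarded as an (invertible) operator on $\mathcal{W}$; and, acting on $((y,w),z,x)$, $$\mathcal{M}=\begin{bmatrix}\sigma A_Q^*A_Q+\mathcal{S}+\widehat{\mathcal{S}}_{\rm sGS}&\mathbf 0&A_Q^*\\ \mathbf 0&\mathbf 0&\mathbf 0\\ A_Q&\mathbf 0&\frac1\sigma I_n\end{bmatrix}.$$ KKT residual: for $u=(y,w,z,x)$, $$\mathcal{R}(u)=\begin{pmatrix}Ax-\Pi_{\mathcal{K}}(Ax-y)\\ Qw-Qx\\ x-\operatorname{Prox}_\phi(x-z)\\ c-A^*y+Qw-z\end{pmatrix}.$$ Objective error: $h(y,w,z)=\tfrac12\langle w,Qw\rangle+\delta_{\mathcal{K}}^*(-y)+\phi^*(-z)-\big(\tfrac12\langle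 w^*,Qw^*\rangle+\delta_{\mathcal{K}}^*(-y^* )+\phi^*(-z^* )\big)$, where $(y^*,w^*,z^* )$ is a solution of (D). The formulas defining $\mathcal{M}$ (hence $\|\cdot\|_{\mathcal{M}}$), $\mathcal{R}$ and $h$ are applied verbatim also when the $w$-component is a vector of $\mathbb{R}^n$ not necessarily in $\mathcal{W}$ (they depend on $w$ only through $Qw$).
   Formalization: In step 1 of Algorithm B the z-independent term δ_K^*(−y^k) of L_σ is dropped from the minimization, since it may be +∞ and then every z would be a minimizer; where it is finite nothing changes. *)

theory Defs
  imports "HOL-Analysis.Analysis"
begin

section \<open>Extended-real-valued convex functions\<close>

definition proper_fun :: "('a \<Rightarrow> ereal) \<Rightarrow> bool" where
  "proper_fun f \<longleftrightarrow> (\<forall>x. f x \<noteq> -\<infinity>) \<and> (\<exists>x. f x \<noteq> \<infinity>)"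

definition epi :: "('a \<Rightarrow> ereal) \<Rightarrow> ('a \<times> real) set" where
  "epi f = {(x, t). f x \<le> ereal t}"

definition closed_fun :: "('a::real_normed_vector \<Rightarrow> ereal) \<Rightarrow> bool" where
  "closed_fun f \<longleftrightarrow> closed (epi f)"

definition convex_fun :: "('a::real_normed_vector \<Rightarrow> ereal) \<Rightarrow> bool" where
  "convex_fun f \<longleftrightarrow> convex (epi f)"

definition indicator_fun :: "'a set \<Rightarrow> 'a \<Rightarrow> ereal" where
  "indicator_fun S x = (if x \<in> S then 0 else \<infinity>)"

definition conjugate :: "('a::real_inner \<Rightarrow> ereal) \<Rightarrow> 'a \<Rightarrow> ereal" where
  "conjugate f s = (SUP x. ereal (s \<bullet> x) - f x)"

text \<open>The subdifferential is empty at points where \<open>f\<close> is not finite.\<close>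

definition subdiff :: "('a::real_inner \<Rightarrow> ereal) \<Rightarrow> 'a \<Rightarrow> 'a set" where
  "subdiff f x = {g. \<bar>f x\<bar> \<noteq> \<infinity> \<and> (\<forall>z. f x + ereal (g \<bullet> (z - x)) \<le> f z)}"

definition prox :: "('a::real_inner \<Rightarrow> ereal) \<Rightarrow> 'a \<Rightarrow> 'a" where
  "prox f x = (ARG_MIN (\<lambda>z. f z + ereal ((norm (z - x))\<^sup>2 / 2)) z. True)"

section \<open>Self-adjoint operators\<close>

definition psd_op :: "('a::euclidean_space \<Rightarrow> 'a) \<Rightarrow> bool" where
  "psd_op T \<longleftrightarrow> linear T \<and> adjoint T = T \<and> (\<forall>x. 0 \<le> x \<bullet> T x)"

definition pd_op :: "('a::euclidean_space \<Rightarrow> 'a) \<Rightarrow> bool" where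
  "pd_op T \<longleftrightarrow> linear T \<and> adjoint T = T \<and> (\<forall>x. x \<noteq> 0 \<longrightarrow> 0 < x \<bullet> T x)"

definition largest_eigenvalue :: "('a::euclidean_space \<Rightarrow> 'a) \<Rightarrow> real" where
  "largest_eigenvalue T = Max {e. \<exists>v. v \<noteq> 0 \<and> T v = e *\<^sub>R v}"

definition op_sqrt :: "('a::euclidean_space \<Rightarrow> 'a) \<Rightarrow> 'a \<Rightarrow> 'a" where
  "op_sqrt T = (THE R. psd_op R \<and> R \<circ> R = T)"

definition seminorm :: "('a::euclidean_space \<Rightarrow> 'a) \<Rightarrow> 'a \<Rightarrow> real" where
  "seminorm M x = sqrt (x \<bullet> M x)"

section \<open>Problem data, KKT system and dual objective\<close>

text \<open>Throughout, points \<open>(y, w, z, x)\<close> are represented as \<open>((y, w), z, x)\<close>.\<close>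

type_synonym ('m, 'n) point = "((real^'m) \<times> (real^'n)) \<times> (real^'n) \<times> (real^'n)"

definition box_set :: "('m::finite \<Rightarrow> ereal) \<Rightarrow> ('m \<Rightarrow> ereal) \<Rightarrow> (real^'m) set" where
  "box_set l u = {y. \<forall>i. l i \<le> ereal (y $ i) \<and> ereal (y $ i) \<le> u i}"

definition is_KKT ::
  "(real^'n \<Rightarrow> real^'n) \<Rightarrow> real^'n \<Rightarrow> (real^'n \<Rightarrow> ereal) \<Rightarrow> (real^'n \<Rightarrow> real^'m)
    \<Rightarrow> (real^'m) set \<Rightarrow> ('m::finite, 'n::finite) point \<Rightarrow> bool" where
  "is_KKT Q c \<phi> A K = (\<lambda>((y, w), z, x).
      w \<in> range Q
    \<and> Q w - Q x = 0
    \<and> A x \<in> subdiff (conjugate (indicator_fun K)) (- y)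
    \<and> x \<in> subdiff (conjugate \<phi>) (- z)
    \<and> - Q w + adjoint A y + z - c = 0)"

definition dual_obj ::
  "(real^'n \<Rightarrow> real^'n) \<Rightarrow> (real^'n \<Rightarrow> ereal) \<Rightarrow> (real^'m) set
    \<Rightarrow> real^'m \<Rightarrow> real^'n \<Rightarrow> real^'n \<Rightarrow> ereal" where
  "dual_obj Q \<phi> K y w z =
     ereal (1/2 * (w \<bullet> Q w)) + conjugate (indicator_fun K) (- y) + conjugate \<phi> (- z)"

definition KKT_residual ::
  "(real^'n \<Rightarrow> real^'n) \<Rightarrow> real^'n \<Rightarrow> (real^'n \<Rightarrow> ereal) \<Rightarrow> (real^'n \<Rightarrow> real^'m)
    \<Rightarrow> (real^'m) set \<Rightarrow> ('m::finite, 'n::finite) point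
    \<Rightarrow> (real^'m) \<times> (real^'n) \<times> (real^'n) \<times> (real^'n)" where
  "KKT_residual Q c \<phi> A K = (\<lambda>((y, w), z, x).
     (A x - closest_point K (A x - y),
      Q w - Q x,
      x - prox \<phi> (x - z),
      c - adjoint A y + Q w - z))"

section \<open>The algorithm\<close>

definition dual_res ::
  "(real^'n \<Rightarrow> real^'n) \<Rightarrow> real^'n \<Rightarrow> (real^'n \<Rightarrow> real^'m)
    \<Rightarrow> real^'m \<Rightarrow> real^'n \<Rightarrow> real^'n \<Rightarrow> real^'n" where
  "dual_res Q c A y w z = - Q w + adjoint A y + z - c"

text \<open>
  The augmented Lagrangian of minimizing \<open>1/2 \<langle>w, Q w\<rangle> + p y + q z\<close> subject to
  \<open>- Q w + A\<^sup>* y + z = c\<close>. The function \<open>L\<^sub>\<sigma>\<close> of the dual problem is the case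
  \<open>p y = \<delta>\<^sub>K\<^sup>* (- y)\<close>, \<open>q z = \<phi>\<^sup>* (- z)\<close>.
\<close>

definition aug_lagrangian ::
  "(real^'n \<Rightarrow> real^'n) \<Rightarrow> real^'n \<Rightarrow> (real^'n \<Rightarrow> real^'m) \<Rightarrow> real
    \<Rightarrow> (real^'m \<Rightarrow> ereal) \<Rightarrow> (real^'n \<Rightarrow> ereal)
    \<Rightarrow> real^'m \<Rightarrow> real^'n \<Rightarrow> real^'n \<Rightarrow> real^'n \<Rightarrow> ereal" where
  "aug_lagrangian Q c A \<sigma> p q y w z x =
     ereal (1/2 * (w \<bullet> Q w)) + p y + q z
     + ereal (x \<bullet> dual_res Q c A y w z + \<sigma>/2 * (norm (dual_res Q c A y w z))\<^sup>2)"

text \<open>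
  The half-step iterate in \<open>w\<close> and the point \<open>2 ub\<^sup>k\<^sup>+\<^sup>1 - u\<^sup>k\<close> are the local \<open>wh\<close> and \<open>uh\<close>;
  \<open>ub 0\<close> is unconstrained and irrelevant.

  In the minimization over \<open>z\<close> the summand \<open>\<delta>\<^sub>K\<^sup>* (- y\<^sup>k)\<close>, which does not depend on \<open>z\<close>, is
  dropped (\<open>p = 0\<close>). The extrapolated \<open>- y\<^sup>k\<close> (and the arbitrary \<open>- y\<^sup>0\<close>) may lie outside the
  domain of \<open>\<delta>\<^sub>K\<^sup>*\<close>; the full augmented Lagrangian would then be identically infinite in \<open>z\<close>
  and every \<open>z\<close> would minimize it. Wherever the summand is finite this changes nothing.
\<close>

definition algorithm_B ::
  "(real^'n \<Rightarrow> real^'n) \<Rightarrow> real^'n \<Rightarrow> (real^'n \<Rightarrow> ereal) \<Rightarrow> (real^'n \<Rightarrow> real^'m)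
    \<Rightarrow> (real^'m) set \<Rightarrow> real \<Rightarrow> real \<Rightarrow> (real^'m \<Rightarrow> real^'m)
    \<Rightarrow> (nat \<Rightarrow> ('m::finite, 'n::finite) point) \<Rightarrow> (nat \<Rightarrow> ('m, 'n) point) \<Rightarrow> bool" where
  "algorithm_B Q c \<phi> A K \<sigma> lamQ Sy u ub \<longleftrightarrow>
    (\<forall>k.
      let ((y, w), z, x) = u k;
          ((yb, wb), zb, xb) = ub (Suc k);
          p = (\<lambda>y. conjugate (indicator_fun K) (- y));
          q = (\<lambda>z. conjugate \<phi> (- z));
          wh = (1 / (1 + \<sigma> * lamQ)) *\<^sub>R
                 ((\<sigma> * lamQ) *\<^sub>R w + xb + \<sigma> *\<^sub>R (dual_res Q c A y w zb));
          uh = 2 *\<^sub>R ub (Suc k) - u k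
      in is_arg_min (\<lambda>z'. aug_lagrangian Q c A \<sigma> (\<lambda>_. 0) q y w z' x) (\<lambda>_. True) zb
       \<and> xb = x + \<sigma> *\<^sub>R (dual_res Q c A y w zb)
       \<and> is_arg_min (\<lambda>y'. aug_lagrangian Q c A \<sigma> p q y' wh zb xb
                          + ereal (\<sigma>/2 * (seminorm Sy (y' - y))\<^sup>2)) (\<lambda>_. True) yb
       \<and> wb = (1 / (1 + \<sigma> * lamQ)) *\<^sub>R
                 ((\<sigma> * lamQ) *\<^sub>R w + xb + \<sigma> *\<^sub>R (dual_res Q c A yb w zb))
       \<and> u (Suc k) = (1 / (real k + 2)) *\<^sub>R u 0 + ((real k + 1) / (real k + 2)) *\<^sub>R uh)"

section \<open>The operators defining the metric\<close>

definition AQ ::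
  "(real^'n \<Rightarrow> real^'n) \<Rightarrow> (real^'n \<Rightarrow> real^'m) \<Rightarrow> (real^'m) \<times> (real^'n) \<Rightarrow> real^'n" where
  "AQ Q A = (\<lambda>(y, w). adjoint A y - Q w)"

definition S_op ::
  "real \<Rightarrow> (real^'m \<Rightarrow> real^'m) \<Rightarrow> (real^'n \<Rightarrow> real^'n)
    \<Rightarrow> (real^'m) \<times> (real^'n) \<Rightarrow> (real^'m) \<times> (real^'n)" where
  "S_op \<sigma> Sy Sw = (\<lambda>(y, w). (\<sigma> *\<^sub>R Sy y, \<sigma> *\<^sub>R Sw w))"

text \<open>
  \<open>inv_into (range Q)\<close> is the inverse of \<open>\<sigma> Q\<^sup>2 + Q + \<sigma> S\<^sub>w\<close> restricted to the range of \<open>Q\<close>.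
\<close>

definition S_sGS ::
  "(real^'n \<Rightarrow> real^'n) \<Rightarrow> (real^'n \<Rightarrow> real^'m) \<Rightarrow> real \<Rightarrow> (real^'n \<Rightarrow> real^'n)
    \<Rightarrow> (real^'m) \<times> (real^'n) \<Rightarrow> (real^'m) \<times> (real^'n)" where
  "S_sGS Q A \<sigma> Sw = (\<lambda>(y, w).
     (\<sigma>\<^sup>2 *\<^sub>R A (Q (inv_into (range Q) (\<lambda>v. \<sigma> *\<^sub>R Q (Q v) + Q v + \<sigma> *\<^sub>R Sw v)
                     (Q (adjoint A y)))), 0))"

definition M_op ::
  "(real^'n \<Rightarrow> real^'n) \<Rightarrow> (real^'n \<Rightarrow> real^'m) \<Rightarrow> real
    \<Rightarrow> (real^'m \<Rightarrow> real^'m) \<Rightarrow> (real^'n \<Rightarrow> real^'n)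
    \<Rightarrow> ('m::finite, 'n::finite) point \<Rightarrow> ('m, 'n) point" where
  "M_op Q A \<sigma> Sy Sw = (\<lambda>(p, z, x).
     (\<sigma> *\<^sub>R adjoint (AQ Q A) (AQ Q A p) + S_op \<sigma> Sy Sw p + S_sGS Q A \<sigma> Sw p
        + adjoint (AQ Q A) x,
      0,
      AQ Q A p + (1 / \<sigma>) *\<^sub>R x))"

end

theory Submission
  imports Defs
begin

text \<open>
  Collect the optimality conditions into one set-valued operator \<open>T\<close>, called \<open>KKT_op\<close> below, among
  whose zeros are the solutions of the KKT system. It is monotone, because subdifferentials and \<open>Q\<close> are and the coupling
  between primal and multiplier variables is skew. The symmetric Gauss-Seidel sweep over \<open>w, y, w\<close>
  in the algorithm is an exact proximal step in disguise: the optimality conditions of the two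
  minimizations and the two closed formulas for \<open>w\<close> combine to \<open>M (u k - ub (k + 1)) \<in> T (ub (k + 1))\<close>
  (\<open>algorithm_B_step\<close>), where the operator \<open>S_sGS\<close> accounts for the half step. Here
  \<open>\<sigma> Q\<^sup>2 + Q + \<sigma> S\<^sub>w = (1 + \<sigma> \<lambda>\<^sub>Q) Q\<close>, so the inverse in \<open>S_sGS\<close> amounts to a division by
  \<open>1 + \<sigma> \<lambda>\<^sub>Q\<close>, the same factor that appears in the half step.

  With this inclusion, the map from \<open>u k\<close> to \<open>2 ub (k + 1) - u k\<close> is
  nonexpansive in the seminorm of \<open>M\<close> and the algorithm is the Halpern iteration of this map. A
  decreasing potential gives \<open>R\<^sub>0 / (k + 1)\<close> for the length of \<open>d = ub (k + 1) - u k\<close> in that seminorm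
  (\<open>Halpern_rate\<close>). The argument takes place entirely in the semi-inner product of \<open>M\<close>, which is
  degenerate.

  The other two estimates read off the vector \<open>v = - M d\<close> in \<open>T\<close> at the computed point. The residual
  has norm at most the norm of \<open>v\<close> (\<open>norm_KKT_residual_le\<close>), again by monotonicity, and \<open>M d\<close> is bounded by the seminorm of \<open>d\<close> (\<open>norm_prox_metric_le\<close>). The subgradient
  inequality of the dual objective, with the multiplier terms added, at the computed point and at the
  solution (\<open>dual_obj_ge\<close>) bounds the objective error from above and from below.
\<close>

section \<open>Positive semidefinite operators and their square roots\<close>

lemma psd_op_sym: "psd_op T \<Longrightarrow> x \<bullet> T y = T x \<bullet> y"
  unfolding psd_op_def by (metis adjoint_works)

lemma psd_op_linear: "psd_op T \<Longrightarrow> linear T"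
  by (simp add: psd_op_def)

lemma psd_op_nonneg: "psd_op T \<Longrightarrow> 0 \<le> x \<bullet> T x"
  by (simp add: psd_op_def)

lemma psd_opI:
  fixes T :: "'a::euclidean_space \<Rightarrow> 'a"
  assumes "linear T" "\<And>x y. x \<bullet> T y = T x \<bullet> y" "\<And>x. 0 \<le> x \<bullet> T x"
  shows "psd_op T"
  unfolding psd_op_def using assms by (auto intro!: adjoint_unique)

text \<open>
  The form may be indefinite off the subspace: the maximizer of a Rayleigh quotient over \<open>V\<close> makes
  \<open>e I - T\<close> nonnegative on \<open>V\<close> only.
\<close>

lemma form_Cauchy_Schwarz:
  fixes T :: "'a::real_inner \<Rightarrow> 'a"
  assumes lin: "linear T" and sym: "\<And>x y. x \<bullet> T y = T x \<bullet> y"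
    and V: "subspace V" and nonneg: "\<And>x. x \<in> V \<Longrightarrow> 0 \<le> x \<bullet> T x"
    and x: "x \<in> V" and y: "y \<in> V"
  shows "(x \<bullet> T y)\<^sup>2 \<le> (x \<bullet> T x) * (y \<bullet> T y)"
proof -
  define a b d where "a = x \<bullet> T x" and "b = x \<bullet> T y" and "d = y \<bullet> T y"
  have ge: "0 \<le> s\<^sup>2 * a + 2 * s * t * b + t\<^sup>2 * d" for s t
  proof -
    have "s *\<^sub>R x + t *\<^sub>R y \<in> V"
      using V x y by (simp add: subspace_add subspace_scale)
    from nonneg[OF this] have "0 \<le> (s *\<^sub>R x + t *\<^sub>R y) \<bullet> T (s *\<^sub>R x + t *\<^sub>R y)" .
    also have "\<dots> = s\<^sup>2 * a + 2 * s * t * b + t\<^sup>2 * d"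
      using sym[of y x]
      by (simp add: a_def b_def d_def linear_add[OF lin] linear_scale[OF lin] inner_add_left
          inner_add_right algebra_simps power2_eq_square inner_commute)
    finally show ?thesis .
  qed
  have d0: "0 \<le> d" using nonneg[OF y] by (simp add: d_def)
  have "b\<^sup>2 \<le> a * d"
  proof (cases "d = 0")
    case True
    have "b = 0"
    proof (rule ccontr)
      assume "b \<noteq> 0"
      have "0 \<le> a + 2 * (- (a + 1) / (2 * b)) * b"
        using ge[of 1 "- (a + 1) / (2 * b)"] True by simp
      also have "\<dots> = -1" using \<open>b \<noteq> 0\<close> by (simp add: field_simps)
      finally show False by simp
    qed
    then show ?thesis using True by simp
  next
    case False
    then have "d > 0" using d0 by simp
    have "0 \<le> d\<^sup>2 * a + 2 * d * (- b) * b + (- b)\<^sup>2 * d" by (rule ge)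
    also have "\<dots> = d * (a * d - b\<^sup>2)" by (simp add: algebra_simps power2_eq_square)
    finally show ?thesis using \<open>d > 0\<close> by (simp add: zero_le_mult_iff)
  qed
  then show ?thesis by (simp add: a_def b_def d_def)
qed

lemma Rayleigh_maximizer:
  fixes T :: "'a::euclidean_space \<Rightarrow> 'a"
  assumes lin: "linear T" and sym: "\<And>x y. x \<bullet> T y = T x \<bullet> y"
    and V: "subspace V" and inv: "T ` V \<subseteq> V" and ne: "V \<noteq> {0}"
  obtains v e where "v \<in> V" "norm v = 1" "T v = e *\<^sub>R v"
    "\<And>x. x \<in> V \<Longrightarrow> x \<bullet> T x \<le> e * (x \<bullet> x)"
proof -
  define S where "S = sphere 0 1 \<inter> V"
  have unit: "(1 / norm x) *\<^sub>R x \<in> S" if "x \<in> V" "x \<noteq> 0" for x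
    using that V by (auto simp: S_def subspace_scale)
  obtain x0 where "x0 \<in> V" "x0 \<noteq> 0"
    using ne V subspace_0 by blast
  then have S_ne: "S \<noteq> {}" using unit by blast
  have "compact S"
    unfolding S_def using closed_subspace[OF V] by (simp add: compact_Int_closed)
  moreover have "continuous_on S (\<lambda>x. x \<bullet> T x)"
    by (intro continuous_intros linear_continuous_on linear_linear[THEN iffD2] lin)
       (use lin in \<open>simp add: linear_conv_bounded_linear\<close>)
  ultimately obtain v where v: "v \<in> S" and vmax: "\<And>x. x \<in> S \<Longrightarrow> x \<bullet> T x \<le> v \<bullet> T v"
    using continuous_attains_sup[OF _ S_ne] by blast
  define e where "e = v \<bullet> T v"
  have vV: "v \<in> V" and nv: "norm v = 1" using v by (auto simp: S_def)
  have vv: "v \<bullet> v = 1" using nv by (simp add: dot_square_norm)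
  have ray: "x \<bullet> T x \<le> e * (x \<bullet> x)" if "x \<in> V" for x
  proof (cases "x = 0")
    case True
    then show ?thesis by simp
  next
    case False
    have "((1 / norm x) *\<^sub>R x) \<bullet> T ((1 / norm x) *\<^sub>R x) \<le> e"
      unfolding e_def by (rule vmax[OF unit[OF that False]])
    then have "(x \<bullet> T x) / (norm x)\<^sup>2 \<le> e"
      by (simp add: linear_scale[OF lin] power2_eq_square)
    then show ?thesis
      using False by (simp add: field_simps dot_square_norm)
  qed
  \<comment> \<open>The form of \<open>e I - T\<close> is nonnegative on \<open>V\<close> and vanishes at \<open>v\<close>, so by Cauchy-Schwarz
      \<open>e v - T v\<close> is orthogonal to \<open>V\<close>, of which it is a member.\<close>
  define G where "G = (\<lambda>x. e *\<^sub>R x - T x)"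
  have Gv: "G v \<in> V"
    unfolding G_def using V vV inv by (auto intro!: subspace_diff subspace_scale)
  have "(G v \<bullet> G v)\<^sup>2 \<le> (G v \<bullet> G (G v)) * (v \<bullet> G v)"
  proof (rule form_Cauchy_Schwarz[OF _ _ V _ Gv vV])
    show "linear G"
      by (rule linearI)
        (simp_all add: G_def linear_add[OF lin] linear_scale[OF lin] algebra_simps)
    show "x \<bullet> G y = G x \<bullet> y" for x y
      by (simp add: G_def inner_diff_left inner_diff_right sym)
    show "0 \<le> x \<bullet> G x" if "x \<in> V" for x
      using ray[OF that] by (simp add: G_def inner_diff_right)
  qed
  moreover have "v \<bullet> G v = 0"
    by (simp add: G_def inner_diff_right vv e_def)
  ultimately have "G v = 0" by simp
  then have "T v = e *\<^sub>R v" by (simp add: G_def)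
  then show ?thesis by (rule that[OF vV nv _ ray])
qed

text \<open>
  Split off a maximizer \<open>v\<close> of the Rayleigh quotient; by symmetry the orthogonal complement of \<open>v\<close>
  inside \<open>V\<close> is again invariant and has smaller dimension.
\<close>

lemma eigenbasis_of_invariant_subspace:
  fixes T :: "'a::euclidean_space \<Rightarrow> 'a"
  assumes lin: "linear T" and sym: "\<And>x y. x \<bullet> T y = T x \<bullet> y"
  shows "subspace V \<Longrightarrow> T ` V \<subseteq> V \<Longrightarrow>
    \<exists>B. B \<subseteq> V \<and> finite B \<and> pairwise orthogonal B \<and> (\<forall>b\<in>B. norm b = 1 \<and> (\<exists>e. T b = e *\<^sub>R b))
      \<and> V \<subseteq> span B"
proof (induction "dim V" arbitrary: V rule: less_induct)
  case less
  show ?case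
  proof (cases "V = {0}")
    case True
    show ?thesis by (rule exI[of _ "{}"]) (simp add: True)
  next
    case False
    from Rayleigh_maximizer[OF lin sym less.prems False]
    obtain v e where v: "v \<in> V" "norm v = 1" "T v = e *\<^sub>R v" by metis
    define W where "W = V \<inter> {x. v \<bullet> x = 0}"
    have W: "subspace W"
      unfolding W_def using less.prems(1) by (auto simp: subspace_def inner_add_right)
    have "v \<notin> W" using v(2) by (auto simp: W_def)
    then have "W \<subset> V" using v(1) unfolding W_def by blast
    then have "dim W < dim V"
      using W less.prems(1) by (metis dim_psubset span_eq_iff)
    moreover have "T ` W \<subseteq> W"
      using less.prems(2) v(3) by (auto simp: W_def sym)
    ultimately obtain B where B: "B \<subseteq> W" "finite B" "pairwise orthogonal B"
      "\<forall>b\<in>B. norm b = 1 \<and> (\<exists>e. T b = e *\<^sub>R b)" "W \<subseteq> span B"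
      using less.hyps[OF _ W] by blast
    have "x \<in> span (insert v B)" if "x \<in> V" for x
    proof -
      have "v \<bullet> v = 1" using v(2) by (simp add: dot_square_norm)
      then have "x - (v \<bullet> x) *\<^sub>R v \<in> W"
        using that v(1) less.prems(1)
        by (auto simp: W_def inner_diff_right intro!: subspace_diff subspace_scale)
      then show ?thesis using B(5) by (auto simp: span_insert)
    qed
    then show ?thesis
      using B v
      by (intro exI[of _ "insert v B"])
        (auto simp: W_def pairwise_insert orthogonal_def inner_commute subset_iff)
  qed
qed

lemma eigenbasis:
  fixes T :: "'a::euclidean_space \<Rightarrow> 'a"
  assumes "linear T" and "\<And>x y. x \<bullet> T y = T x \<bullet> y"
  obtains B e where "finite B" "\<And>b. b \<in> B \<Longrightarrow> b \<bullet> b = 1" "\<And>b. b \<in> B \<Longrightarrow> T b = e b *\<^sub>R b"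
    "\<And>a b. a \<in> B \<Longrightarrow> b \<in> B \<Longrightarrow> a \<noteq> b \<Longrightarrow> a \<bullet> b = 0"
    "\<And>x. x = (\<Sum>b\<in>B. (b \<bullet> x) *\<^sub>R b)"
proof -
  obtain B where B: "finite B" "pairwise orthogonal B"
      "\<forall>b\<in>B. norm b = 1 \<and> (\<exists>e. T b = e *\<^sub>R b)" "span B = UNIV"
    using eigenbasis_of_invariant_subspace[OF assms subspace_UNIV] by auto
  obtain e where e: "\<And>b. b \<in> B \<Longrightarrow> T b = e b *\<^sub>R b" using B(3) by metis
  have ortho: "a \<bullet> b = 0" if "a \<in> B" "b \<in> B" "a \<noteq> b" for a b
    using B(2) that by (auto simp: pairwise_def orthogonal_def)
  have unit: "b \<bullet> b = 1" if "b \<in> B" for b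
    using B(3) that by (simp add: dot_square_norm)
  have "x = (\<Sum>b\<in>B. (b \<bullet> x) *\<^sub>R b)" for x
  proof -
    define r where "r = x - (\<Sum>b\<in>B. (b \<bullet> x) *\<^sub>R b)"
    have "b \<bullet> r = 0" if "b \<in> B" for b
    proof -
      have "b \<bullet> (\<Sum>a\<in>B. (a \<bullet> x) *\<^sub>R a) = (\<Sum>a\<in>B. if a = b then b \<bullet> x else 0)"
        unfolding inner_sum_right by (rule sum.cong) (use ortho that unit in auto)
      then show ?thesis using that B(1) by (simp add: r_def inner_diff_right)
    qed
    then have "orthogonal r y" for y
      using orthogonal_to_span[of y B r] B(4)
      by (auto simp: orthogonal_def inner_commute)
    from this[of r] have "r = 0" by (simp add: orthogonal_def)
    then show ?thesis by (simp add: r_def)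
  qed
  with B(1) unit e ortho show ?thesis by (rule that)
qed

text \<open>
  The maximum in \<open>largest_eigenvalue\<close> is over a finite set, since an eigenvector has a nonzero
  component along some member of an eigenbasis and hence shares its eigenvalue. The set contains the
  maximum of the Rayleigh quotient.
\<close>

lemma inner_le_largest_eigenvalue:
  fixes T :: "'a::euclidean_space \<Rightarrow> 'a"
  assumes lin: "linear T" and sym: "\<And>x y. x \<bullet> T y = T x \<bullet> y"
  shows "x \<bullet> T x \<le> largest_eigenvalue T * (x \<bullet> x)"
proof -
  define E where "E = {e. \<exists>v. v \<noteq> 0 \<and> T v = e *\<^sub>R v}"
  obtain B f where B: "finite B" "\<And>b. b \<in> B \<Longrightarrow> b \<bullet> b = 1" "\<And>b. b \<in> B \<Longrightarrow> T b = f b *\<^sub>R b"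
    "\<And>a b. a \<in> B \<Longrightarrow> b \<in> B \<Longrightarrow> a \<noteq> b \<Longrightarrow> a \<bullet> b = 0" "\<And>x. x = (\<Sum>b\<in>B. (b \<bullet> x) *\<^sub>R b)"
    by (rule eigenbasis[OF lin sym]) (rule that)
  have "E \<subseteq> f ` B"
  proof
    fix e assume "e \<in> E"
    then obtain v where v: "v \<noteq> 0" "T v = e *\<^sub>R v" by (auto simp: E_def)
    have "\<not> (\<forall>b\<in>B. b \<bullet> v = 0)"
      using B(5)[of v] v(1) sum.neutral[of B "\<lambda>b. (b \<bullet> v) *\<^sub>R b"] by auto
    then obtain b where b: "b \<in> B" "b \<bullet> v \<noteq> 0" by blast
    have "e * (b \<bullet> v) = f b * (b \<bullet> v)"
      using sym[of b v] B(3)[OF b(1)] v(2) by simp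
    then show "e \<in> f ` B" using b by auto
  qed
  then have fin: "finite E" using B(1) finite_surj by blast
  have "(UNIV::'a set) \<noteq> {0}"
    by (metis UNIV_I UNIV_not_singleton)
  then obtain v e where v: "norm v = 1" "T v = e *\<^sub>R v"
    and ray: "\<And>x. x \<bullet> T x \<le> e * (x \<bullet> x)"
    using Rayleigh_maximizer[OF lin sym subspace_UNIV] by auto
  have "v \<noteq> 0" using v(1) by auto
  then have "e \<in> E" using v(2) by (auto simp: E_def)
  then have "e \<le> largest_eigenvalue T"
    unfolding largest_eigenvalue_def E_def[symmetric] using fin by simp
  then have "e * (x \<bullet> x) \<le> largest_eigenvalue T * (x \<bullet> x)" by (simp add: mult_right_mono)
  with ray[of x] show ?thesis by simp
qed

text \<open>
  On an eigenvector of \<open>R\<close> with eigenvalue \<open>r\<close>, \<open>R'\<close> must agree with \<open>R\<close> because \<open>R'\<^sup>2 - r\<^sup>2\<close> factors.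
\<close>

lemma psd_sqrt_unique:
  fixes T :: "'a::euclidean_space \<Rightarrow> 'a"
  assumes R: "psd_op R" "R \<circ> R = T" and R': "psd_op R'" "R' \<circ> R' = T"
  shows "R = R'"
proof -
  have lin: "linear R" "linear R'" using R R' by (auto simp: psd_op_def)
  obtain B r where B: "finite B" "\<And>b. b \<in> B \<Longrightarrow> b \<bullet> b = 1" "\<And>b. b \<in> B \<Longrightarrow> R b = r b *\<^sub>R b"
    "\<And>a b. a \<in> B \<Longrightarrow> b \<in> B \<Longrightarrow> a \<noteq> b \<Longrightarrow> a \<bullet> b = 0" "\<And>x. x = (\<Sum>b\<in>B. (b \<bullet> x) *\<^sub>R b)"
    by (rule eigenbasis[OF lin(1) psd_op_sym[OF R(1)]]) (rule that)
  have eq: "R' b = R b" if b: "b \<in> B" for b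
  proof -
    have r0: "0 \<le> r b"
      using R(1) B(2,3)[OF b] by (metis inner_scaleR_right mult.right_neutral psd_op_def)
    have sq: "R' (R' b) = (r b)\<^sup>2 *\<^sub>R b"
    proof -
      have "R' (R' b) = R (R b)" using R(2) R'(2) by (metis comp_apply)
      then show ?thesis
        using B(3)[OF b] by (simp add: linear_scale[OF lin(1)] power2_eq_square)
    qed
    \<comment> \<open>\<open>d\<close> satisfies \<open>(R' + r b) d = 0\<close>, and \<open>R' + r b\<close> is positive definite unless \<open>r b = 0\<close>.\<close>
    define d where "d = R' b - r b *\<^sub>R b"
    have d: "R' d = - r b *\<^sub>R d"
      using sq by (simp add: d_def linear_diff[OF lin(2)] linear_scale[OF lin(2)]
          scaleR_diff_right power2_eq_square)
    have "d \<bullet> d = 0"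
    proof (cases "r b = 0")
      case True
      have "d \<bullet> d = R' b \<bullet> R' b" using True by (simp add: d_def)
      also have "\<dots> = b \<bullet> R' (R' b)" using psd_op_sym[OF R'(1)] by simp
      finally show ?thesis using sq True by simp
    next
      case False
      have "0 \<le> d \<bullet> R' d" using R'(1) by (simp add: psd_op_def)
      then have "r b * (d \<bullet> d) \<le> 0" by (simp add: d)
      then show ?thesis using False r0
        by (smt (verit) inner_ge_zero mult_pos_pos)
    qed
    then show ?thesis using B(3)[OF b] by (simp add: d_def)
  qed
  show ?thesis
  proof
    fix x
    have expand: "L x = (\<Sum>b\<in>B. (b \<bullet> x) *\<^sub>R L b)" if L: "linear L" for L :: "'a \<Rightarrow> 'a"
    proof -
      have "L x = L (\<Sum>b\<in>B. (b \<bullet> x) *\<^sub>R b)" using B(5)[of x] by simp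
      then show ?thesis by (simp add: linear_sum[OF L] linear_scale[OF L])
    qed
    show "R x = R' x"
      unfolding expand[OF lin(1)] expand[OF lin(2)] using eq by simp
  qed
qed

lemma psd_sqrt_exists:
  fixes T :: "'a::euclidean_space \<Rightarrow> 'a"
  assumes T: "psd_op T"
  shows "\<exists>R. psd_op R \<and> R \<circ> R = T"
proof -
  have lin: "linear T" using T by (simp add: psd_op_def)
  obtain B e where B: "finite B" "\<And>b. b \<in> B \<Longrightarrow> b \<bullet> b = 1" "\<And>b. b \<in> B \<Longrightarrow> T b = e b *\<^sub>R b"
    "\<And>a b. a \<in> B \<Longrightarrow> b \<in> B \<Longrightarrow> a \<noteq> b \<Longrightarrow> a \<bullet> b = 0" "\<And>x. x = (\<Sum>b\<in>B. (b \<bullet> x) *\<^sub>R b)"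
    by (rule eigenbasis[OF lin psd_op_sym[OF T]]) (rule that)
  have e0: "0 \<le> e b" if "b \<in> B" for b
    using T B(2,3)[OF that] by (metis inner_scaleR_right mult.right_neutral psd_op_def)
  define R where "R = (\<lambda>x. \<Sum>b\<in>B. (sqrt (e b) * (b \<bullet> x)) *\<^sub>R b)"
  have dotR: "b \<bullet> R x = sqrt (e b) * (b \<bullet> x)" if "b \<in> B" for b x
  proof -
    have "b \<bullet> R x = (\<Sum>a\<in>B. if a = b then sqrt (e b) * (b \<bullet> x) else 0)"
      unfolding R_def inner_sum_right by (rule sum.cong) (use B(2,4) that in auto)
    then show ?thesis using that B(1) by simp
  qed
  have "psd_op R"
  proof (rule psd_opI)
    show "linear R"
      unfolding R_def
      by (rule linearI)
        (simp_all add: inner_add_right algebra_simps sum.distrib scaleR_sum_right)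
    show "x \<bullet> R y = R x \<bullet> y" for x y
      by (simp add: R_def inner_sum_right inner_sum_left inner_commute mult.commute mult.left_commute)
    have "x \<bullet> R x = (\<Sum>b\<in>B. sqrt (e b) * (b \<bullet> x)\<^sup>2)" for x
      by (simp add: R_def inner_sum_right inner_commute power2_eq_square mult.assoc)
    then show "0 \<le> x \<bullet> R x" for x
      using e0 by (auto intro!: sum_nonneg)
  qed
  moreover have "R (R x) = T x" for x
  proof -
    have "R (R x) = (\<Sum>b\<in>B. (sqrt (e b) * (b \<bullet> R x)) *\<^sub>R b)" by (simp add: R_def)
    also have "\<dots> = (\<Sum>b\<in>B. (e b * (b \<bullet> x)) *\<^sub>R b)"
      by (rule sum.cong) (use e0 in \<open>auto simp: dotR\<close>)
    also have "\<dots> = (\<Sum>b\<in>B. (b \<bullet> x) *\<^sub>R T b)"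
      by (rule sum.cong) (auto simp: B(3) mult.commute)
    also have "\<dots> = T (\<Sum>b\<in>B. (b \<bullet> x) *\<^sub>R b)"
      by (simp add: linear_sum[OF lin] linear_scale[OF lin])
    also have "\<dots> = T x" using B(5)[of x] by simp
    finally show ?thesis .
  qed
  ultimately show ?thesis by (auto simp: fun_eq_iff)
qed

lemma op_sqrt:
  fixes T :: "'a::euclidean_space \<Rightarrow> 'a"
  assumes "psd_op T"
  shows "psd_op (op_sqrt T)" and "op_sqrt T (op_sqrt T x) = T x"
proof -
  have "\<exists>!R. psd_op R \<and> R \<circ> R = T"
    using psd_sqrt_exists[OF assms] psd_sqrt_unique by blast
  from theI'[OF this] have "psd_op (op_sqrt T) \<and> op_sqrt T \<circ> op_sqrt T = T"
    by (simp add: op_sqrt_def)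
  then show "psd_op (op_sqrt T)" "op_sqrt T (op_sqrt T x) = T x"
    by (auto simp: fun_eq_iff)
qed

lemma norm_psd_op_le:
  fixes T :: "'a::euclidean_space \<Rightarrow> 'a"
  assumes T: "psd_op T"
  shows "norm (T x) \<le> onorm (op_sqrt T) * seminorm T x"
proof -
  have "norm (op_sqrt T x) = seminorm T x"
    using psd_op_sym[OF op_sqrt(1)[OF T]]
    by (metis T norm_eq_sqrt_inner op_sqrt(2) seminorm_def)
  moreover have "norm (op_sqrt T (op_sqrt T x)) \<le> onorm (op_sqrt T) * norm (op_sqrt T x)"
    using op_sqrt(1)[OF T] by (intro onorm) (simp add: psd_op_def linear_conv_bounded_linear)
  ultimately show ?thesis by (simp add: op_sqrt(2)[OF T])
qed

text \<open>
  The operator inequality \<open>T\<^sup>2 \<le> lam T\<close>, which makes \<open>S\<^sub>w = Q (\<lambda>\<^sub>Q I - Q)\<close> positive semidefinite.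
  Cauchy-Schwarz for the form of \<open>T\<close>, applied to \<open>T x\<close> and \<open>x\<close>, reduces it to the bound on the
  Rayleigh quotient at \<open>T x\<close>.
\<close>

lemma norm_sq_psd_op_le:
  fixes T :: "'a::euclidean_space \<Rightarrow> 'a"
  assumes T: "psd_op T" and lam: "largest_eigenvalue T \<le> lam"
  shows "T x \<bullet> T x \<le> lam * (x \<bullet> T x)"
proof (cases "T x = 0")
  case True
  then show ?thesis by simp
next
  case False
  have lin: "linear T" and nn: "\<And>x. 0 \<le> x \<bullet> T x" using T by (auto simp: psd_op_def)
  have bound: "T x \<bullet> T (T x) \<le> lam * (T x \<bullet> T x)"
    using inner_le_largest_eigenvalue[OF lin psd_op_sym[OF T], of "T x"] lam
    by (meson inner_ge_zero mult_right_mono order_trans)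
  have "(T x \<bullet> T x)\<^sup>2 \<le> (T x \<bullet> T (T x)) * (x \<bullet> T x)"
    using form_Cauchy_Schwarz[OF lin psd_op_sym[OF T] subspace_UNIV, of "T x" x] nn by simp
  also have "\<dots> \<le> (lam * (T x \<bullet> T x)) * (x \<bullet> T x)"
    by (rule mult_right_mono[OF bound nn])
  finally have "(T x \<bullet> T x) * (T x \<bullet> T x) \<le> (T x \<bullet> T x) * (lam * (x \<bullet> T x))"
    by (simp add: power2_eq_square algebra_simps)
  then show ?thesis using False by (simp add: mult_le_cancel_left)
qed

section \<open>Conjugates, proximal maps and projections\<close>

lemma conjugate_ge: "ereal (s \<bullet> x) - f x \<le> conjugate f s"
  unfolding conjugate_def by (rule SUP_upper) simp

lemma Fenchel_Young:
  assumes "conjugate f s \<le> ereal b" "f x \<le> ereal t"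
  shows "s \<bullet> x - t \<le> b"
proof -
  have "ereal (s \<bullet> x) - ereal t \<le> ereal (s \<bullet> x) - f x"
    using assms(2) by (rule ereal_minus_mono[OF order_refl])
  also have "\<dots> \<le> ereal b" using conjugate_ge assms(1) by (rule order_trans)
  finally show ?thesis by simp
qed

lemma conjugate_not_MInf:
  assumes "f x0 \<noteq> \<infinity>"
  shows "conjugate f s \<noteq> -\<infinity>"
proof -
  have "ereal (s \<bullet> x0) - f x0 \<noteq> -\<infinity>" using assms by (cases "f x0") auto
  then show ?thesis using conjugate_ge[of s x0 f] by auto
qed

text \<open>
  The epigraph of a conjugate is the intersection over \<open>x\<close> of sets each of which is a half-space,
  the whole space or empty, according to the value \<open>f x\<close>.
\<close>

lemma convex_fun_conjugate: "convex_fun (conjugate f)"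
proof -
  have eq: "epi (conjugate f) = (\<Inter>x. {(s, t). ereal (s \<bullet> x) - f x \<le> ereal t})"
    by (auto simp: epi_def conjugate_def SUP_le_iff)
  have "convex {(s, t). ereal (s \<bullet> x) - f x \<le> ereal t}" for x
  proof (cases "f x")
    case (real r)
    have "{(s, t). ereal (s \<bullet> x) - f x \<le> ereal t} = {p. (x, - 1) \<bullet> p \<le> r}"
      by (auto simp: real inner_commute)
    then show ?thesis by (simp add: convex_halfspace_le)
  next
    case PInf
    then have "{(s, t). ereal (s \<bullet> x) - f x \<le> ereal t} = UNIV" by auto
    then show ?thesis by simp
  next
    case MInf
    then have "{(s, t). ereal (s \<bullet> x) - f x \<le> ereal t} = {}" by auto
    then show ?thesis by simp
  qed
  then show ?thesis
    unfolding convex_fun_def eq by (auto intro!: convex_INT)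
qed

lemma convex_fun_reflect:
  assumes "convex_fun f"
  shows "convex_fun (\<lambda>z. f (- z))"
proof -
  have "epi (\<lambda>z. f (- z)) = (\<lambda>(z, t). (- z, t)) -` epi f" by (auto simp: epi_def)
  moreover have "linear (\<lambda>(z, t). (- z, t :: real))"
    by (rule linearI) auto
  ultimately show ?thesis
    using assms convex_linear_vimage unfolding convex_fun_def by metis
qed

lemma convex_fun_segment:
  assumes f: "convex_fun f" and a: "f a \<le> ereal r" and b: "f b \<le> ereal s" and t: "0 \<le> t" "t \<le> 1"
  shows "f (a + t *\<^sub>R (b - a)) \<le> ereal (r + t * (s - r))"
proof -
  have "(a, r) \<in> epi f" "(b, s) \<in> epi f" using a b by (auto simp: epi_def)
  then have "(1 - t) *\<^sub>R (a, r) + t *\<^sub>R (b, s) \<in> epi f"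
    using f t unfolding convex_fun_def by (intro convexD_alt) auto
  moreover have "(1 - t) *\<^sub>R (a, r) + t *\<^sub>R (b, s) = (a + t *\<^sub>R (b - a), r + t * (s - r))"
    by (simp add: algebra_simps)
  ultimately show ?thesis by (simp add: epi_def)
qed

text \<open>
  Fermat's rule for \<open>f + g\<close> with \<open>f\<close> convex and \<open>g\<close> quadratic, where \<open>l\<close> is the gradient of \<open>g\<close> at
  \<open>a\<close> and \<open>q d\<close> the second-order coefficient in direction \<open>d\<close>: compare \<open>a\<close> with the point
  \<open>a + t (z - a)\<close>, divide by \<open>t\<close> and let \<open>t\<close> tend to \<open>0\<close>.
\<close>

lemma argmin_subgradient:
  fixes f :: "'a::real_inner \<Rightarrow> ereal"
  assumes f: "convex_fun f" "\<And>x. f x \<noteq> -\<infinity>" "f x0 \<noteq> \<infinity>"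
    and argmin: "is_arg_min (\<lambda>z. f z + ereal (g z)) (\<lambda>_. True) a"
    and g: "\<And>d t. g (a + t *\<^sub>R d) = g a + t * (l \<bullet> d) + t\<^sup>2 * q d"
  shows "- l \<in> subdiff f a"
proof -
  have min: "f a + ereal (g a) \<le> f z + ereal (g z)" for z
    using argmin by (auto simp: is_arg_min_linorder)
  have "f a \<noteq> \<infinity>" using min[of x0] f(3) f(2)[of x0] by (cases "f x0") auto
  with f(2)[of a] obtain r where r: "f a = ereal r" by (cases "f a") auto
  have "f a + ereal (- l \<bullet> (z - a)) \<le> f z" for z
  proof (cases "f z")
    case (real s)
    define d where "d = z - a"
    have le: "r \<le> s + l \<bullet> d + t * q d" if t: "0 < t" "t < 1" for t
    proof -
      have "f (a + t *\<^sub>R d) \<le> ereal (r + t * (s - r))"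
        unfolding d_def by (rule convex_fun_segment[OF f(1)]) (use t r real in auto)
      then have "f (a + t *\<^sub>R d) + ereal (g (a + t *\<^sub>R d))
          \<le> ereal (r + t * (s - r)) + ereal (g (a + t *\<^sub>R d))"
        by (rule add_right_mono)
      with min[of "a + t *\<^sub>R d"]
      have "f a + ereal (g a) \<le> ereal (r + t * (s - r)) + ereal (g (a + t *\<^sub>R d))"
        by (rule order_trans)
      then have "r + g a \<le> r + t * (s - r) + g (a + t *\<^sub>R d)" by (simp add: r)
      then have "0 \<le> t * (s - r + l \<bullet> d + t * q d)"
        by (simp add: g algebra_simps power2_eq_square)
      then show ?thesis using t by (simp add: zero_le_mult_iff)
    qed
    have "((\<lambda>t. s + l \<bullet> d + t * q d) \<longlongrightarrow> s + l \<bullet> d + 0 * q d) (at_right 0)"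
      by (intro tendsto_intros)
    moreover have "\<forall>\<^sub>F t in at_right 0. r \<le> s + l \<bullet> d + t * q d"
      unfolding eventually_at_right_field by (intro exI[of _ 1]) (auto intro: le)
    ultimately have "r \<le> s + l \<bullet> d + 0 * q d"
      by (intro tendsto_lowerbound) auto
    then show ?thesis by (simp add: real r d_def)
  qed (use f(2)[of z] in auto)
  then show ?thesis by (simp add: subdiff_def r)
qed

lemma subdiff_reflect:
  "g \<in> subdiff (\<lambda>z. f (- z)) a \<Longrightarrow> - g \<in> subdiff f (- a)"
proof -
  assume g: "g \<in> subdiff (\<lambda>z. f (- z)) a"
  have "f (- a) + ereal (- g \<bullet> (z - - a)) \<le> f z" for z
  proof -
    have "f (- a) + ereal (g \<bullet> (- z - a)) \<le> f (- (- z))"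
      using g unfolding subdiff_def by blast
    moreover have "g \<bullet> (- z - a) = - g \<bullet> (z - - a)" by (simp add: inner_diff_right inner_add_right)
    ultimately show ?thesis by simp
  qed
  then show ?thesis using g by (simp add: subdiff_def)
qed

lemma subdiff_monotone:
  assumes "g \<in> subdiff f x" "g' \<in> subdiff f x'"
  shows "0 \<le> (g - g') \<bullet> (x - x')"
proof -
  obtain r where r: "f x = ereal r" using assms(1) by (auto simp: subdiff_def)
  obtain r' where r': "f x' = ereal r'" using assms(2) by (auto simp: subdiff_def)
  have "f x + ereal (g \<bullet> (x' - x)) \<le> f x'" "f x' + ereal (g' \<bullet> (x - x')) \<le> f x"
    using assms by (auto simp: subdiff_def)
  then have "g \<bullet> (x' - x) + g' \<bullet> (x - x') \<le> 0" by (simp add: r r')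
  then show ?thesis by (simp add: inner_diff_left inner_diff_right)
qed

lemma subdiff_conjugate_of_subdiff:
  assumes "s \<in> subdiff f x"
  shows "x \<in> subdiff (conjugate f) s"
proof -
  obtain r where r: "f x = ereal r" using assms by (auto simp: subdiff_def)
  have ineq: "ereal (r + s \<bullet> (z - x)) \<le> f z" for z
    using assms r by (auto simp: subdiff_def)
  have "conjugate f s \<le> ereal (s \<bullet> x - r)"
    unfolding conjugate_def
  proof (rule SUP_least)
    fix z show "ereal (s \<bullet> z) - f z \<le> ereal (s \<bullet> x - r)"
      using ineq[of z] by (cases "f z") (auto simp: inner_diff_right)
  qed
  moreover have "ereal (s \<bullet> x - r) \<le> conjugate f s"
    using conjugate_ge[of s x f] by (simp add: r)
  ultimately have val: "conjugate f s = ereal (s \<bullet> x - r)" by simp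
  have "conjugate f s + ereal (x \<bullet> (z - s)) \<le> conjugate f z" for z
    using conjugate_ge[of z x f] by (simp add: val r inner_diff_right inner_commute)
  then show ?thesis by (simp add: subdiff_def val)
qed

text \<open>
  A single point of finite conjugate, which the KKT system supplies, is the slope of an affine minorant
  of \<open>f\<close>. The regularized function is therefore coercive; it attains its minimum because the epigraph
  is closed.
\<close>

lemma is_arg_min_prox:
  fixes f :: "'a::euclidean_space \<Rightarrow> ereal"
  assumes f: "proper_fun f" "closed_fun f" and s: "conjugate f s \<noteq> \<infinity>"
  shows "is_arg_min (\<lambda>z. f z + ereal ((norm (z - p))\<^sup>2 / 2)) (\<lambda>_. True) (prox f p)"
proof -
  have fin: "f x \<noteq> -\<infinity>" for x using f(1) by (simp add: proper_fun_def)
  obtain x0 where x0: "f x0 \<noteq> \<infinity>" using f(1) by (auto simp: proper_fun_def)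
  then obtain r0 where r0: "f x0 = ereal r0" using fin[of x0] by (cases "f x0") auto
  obtain b where b: "conjugate f s = ereal b"
    using s conjugate_not_MInf[of f x0 s, OF x0] by (cases "conjugate f s") auto
  have minorant: "s \<bullet> x - b \<le> t" if "(x, t) \<in> epi f" for x t
    using Fenchel_Young[of f s b x t] that b by (simp add: epi_def)
  define G where "G = (\<lambda>(z, t). t + (norm (z - p))\<^sup>2 / 2)"
  define m where "m = r0 + (norm (x0 - p))\<^sup>2 / 2"
  define C where "C = epi f \<inter> {w. G w \<le> m}"
  have G_cont: "continuous_on UNIV G"
    unfolding G_def case_prod_beta by (intro continuous_intros) auto
  have "closed C"
    unfolding C_def using f(2) unfolding closed_fun_def
    by (intro closed_Int closed_Collect_le G_cont continuous_on_const) auto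
  moreover have "bounded C"
  proof -
    define \<rho> where "\<rho> = norm s + sqrt ((norm s)\<^sup>2 + 2 * \<bar>m + b - s \<bullet> p\<bar>)"
    have z: "norm (z - p) \<le> \<rho>" and t: "\<bar>t\<bar> \<le> \<bar>m\<bar> + \<bar>b\<bar> + norm s * (\<rho> + norm p)"
      if "(z, t) \<in> C" for z t
    proof -
      have e: "(z, t) \<in> epi f" and g: "t + (norm (z - p))\<^sup>2 / 2 \<le> m"
        using that by (auto simp: C_def G_def)
      have "- (norm s * norm (z - p)) \<le> s \<bullet> (z - p)"
        using Cauchy_Schwarz_ineq2[of s "z - p"] by linarith
      then have "(norm (z - p))\<^sup>2 \<le> 2 * (m + b - s \<bullet> p) + 2 * (norm s * norm (z - p))"
        using minorant[OF e] g by (simp add: inner_diff_right algebra_simps)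
      also have "\<dots> \<le> 2 * \<bar>m + b - s \<bullet> p\<bar> + 2 * (norm s * norm (z - p))"
        by (intro add_right_mono mult_left_mono abs_ge_self) simp
      finally have "(norm (z - p))\<^sup>2 - 2 * (norm s * norm (z - p)) \<le> 2 * \<bar>m + b - s \<bullet> p\<bar>"
        by simp
      then have "(norm (z - p) - norm s)\<^sup>2 \<le> (norm s)\<^sup>2 + 2 * \<bar>m + b - s \<bullet> p\<bar>"
        by (simp add: power2_diff mult.commute)
      then have "norm (z - p) - norm s \<le> sqrt ((norm s)\<^sup>2 + 2 * \<bar>m + b - s \<bullet> p\<bar>)"
        by (rule real_le_rsqrt)
      then show z: "norm (z - p) \<le> \<rho>" by (simp add: \<rho>_def)
      have "norm z \<le> \<rho> + norm p" using z norm_triangle_sub[of z p] by linarith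
      then have "norm s * norm z \<le> norm s * (\<rho> + norm p)" by (simp add: mult_left_mono)
      then have "\<bar>s \<bullet> z\<bar> \<le> norm s * (\<rho> + norm p)"
        using Cauchy_Schwarz_ineq2[of s z] by linarith
      moreover have "0 \<le> (norm (z - p))\<^sup>2 / 2" by simp
      ultimately show "\<bar>t\<bar> \<le> \<bar>m\<bar> + \<bar>b\<bar> + norm s * (\<rho> + norm p)"
        using minorant[OF e] g by linarith
    qed
    have "C \<subseteq> cball p \<rho> \<times> cball 0 (\<bar>m\<bar> + \<bar>b\<bar> + norm s * (\<rho> + norm p))"
      using z t by (auto simp: dist_norm norm_minus_commute)
    then show ?thesis by (rule bounded_subset[OF bounded_Times[OF bounded_cball bounded_cball]])
  qed
  ultimately have "compact C" by (simp add: compact_eq_bounded_closed)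
  moreover have x0C: "(x0, r0) \<in> C" by (simp add: C_def epi_def G_def m_def r0)
  ultimately obtain z1 t1 where z1: "(z1, t1) \<in> C" and min: "\<And>w. w \<in> C \<Longrightarrow> G (z1, t1) \<le> G w"
    using continuous_attains_inf[of C G] continuous_on_subset[OF G_cont]
    by (metis empty_iff subset_UNIV surj_pair)
  have "f z1 + ereal ((norm (z1 - p))\<^sup>2 / 2) \<le> f z + ereal ((norm (z - p))\<^sup>2 / 2)" for z
  proof (cases "f z")
    case (real t)
    have "f z1 \<le> ereal t1" using z1 by (simp add: C_def epi_def)
    then have "f z1 + ereal ((norm (z1 - p))\<^sup>2 / 2) \<le> ereal t1 + ereal ((norm (z1 - p))\<^sup>2 / 2)"
      by (rule add_right_mono)
    also have "\<dots> = ereal (G (z1, t1))" by (simp add: G_def)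
    also have "\<dots> \<le> ereal (G (z, t))"
    proof (cases "(z, t) \<in> C")
      case True
      then show ?thesis using min by simp
    next
      case False
      then have "m \<le> G (z, t)" by (auto simp: C_def epi_def real)
      moreover have "G (z1, t1) \<le> m" using z1 by (simp add: C_def)
      ultimately show ?thesis by simp
    qed
    also have "\<dots> = f z + ereal ((norm (z - p))\<^sup>2 / 2)" by (simp add: G_def real)
    finally show ?thesis .
  qed (use fin[of z] in auto)
  then have "is_arg_min (\<lambda>z. f z + ereal ((norm (z - p))\<^sup>2 / 2)) (\<lambda>_. True) z1"
    by (simp add: is_arg_min_linorder)
  then show ?thesis unfolding prox_def arg_min_def by (rule someI)
qed

lemma prox_subdiff:
  fixes f :: "'a::euclidean_space \<Rightarrow> ereal"
  assumes f: "proper_fun f" "closed_fun f" "convex_fun f" and s: "conjugate f s \<noteq> \<infinity>"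
  shows "p - prox f p \<in> subdiff f (prox f p)"
proof -
  obtain x0 where x0: "f x0 \<noteq> \<infinity>" using f(1) by (auto simp: proper_fun_def)
  have "- (prox f p - p) \<in> subdiff f (prox f p)"
  proof (rule argmin_subgradient[OF f(3) _ x0 is_arg_min_prox[OF f(1,2) s]])
    show "f x \<noteq> -\<infinity>" for x using f(1) by (simp add: proper_fun_def)
    show "(norm (prox f p + t *\<^sub>R d - p))\<^sup>2 / 2
        = (norm (prox f p - p))\<^sup>2 / 2 + t * ((prox f p - p) \<bullet> d) + t\<^sup>2 * ((norm d)\<^sup>2 / 2)" for d t
      unfolding power2_norm_eq_inner
      by (simp add: inner_add_left inner_add_right inner_diff_left inner_diff_right
          inner_commute power2_eq_square field_simps)
  qed
  then show ?thesis by simp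
qed

text \<open>
  Both hypotheses place a point in the graph of the same monotone operator. If \<open>v = 0\<close> this says that
  \<open>xh\<close> is determined by \<open>x - z\<close>. Below, \<open>f\<close> is a conjugate and \<open>xh\<close> a proximal point or a projection,
  whose membership follows from its optimality condition and \<open>subdiff_conjugate_of_subdiff\<close>.
\<close>

lemma norm_resolvent_residual_le:
  fixes f :: "'a::real_inner \<Rightarrow> ereal"
  assumes "x - v \<in> subdiff f (- z)" and "xh \<in> subdiff f (x - z - xh)"
  shows "norm (x - xh) \<le> norm v"
proof -
  have "0 \<le> (x - v - xh) \<bullet> (- z - (x - z - xh))"
    by (rule subdiff_monotone[OF assms])
  then have "(x - xh) \<bullet> (x - xh) \<le> v \<bullet> (x - xh)"
    by (simp add: algebra_simps inner_diff_left inner_diff_right inner_commute)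
  also have "\<dots> \<le> norm v * norm (x - xh)" by (rule norm_cauchy_schwarz)
  finally have "norm (x - xh) * norm (x - xh) \<le> norm v * norm (x - xh)"
    by (simp add: dot_square_norm power2_eq_square)
  then show ?thesis by (cases "x = xh") auto
qed

lemma norm_prox_residual_le:
  fixes f :: "'a::euclidean_space \<Rightarrow> ereal"
  assumes f: "proper_fun f" "closed_fun f" "convex_fun f"
    and v: "x - v \<in> subdiff (conjugate f) (- z)"
  shows "norm (x - prox f (x - z)) \<le> norm v"
proof (rule norm_resolvent_residual_le[OF v])
  have "conjugate f (- z) \<noteq> \<infinity>" using v by (auto simp: subdiff_def)
  then show "prox f (x - z) \<in> subdiff (conjugate f) (x - z - prox f (x - z))"
    by (intro subdiff_conjugate_of_subdiff prox_subdiff f)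
qed

lemma indicator_conjugate_finite_nonempty:
  assumes "\<bar>conjugate (indicator_fun K) s\<bar> \<noteq> \<infinity>"
  shows "K \<noteq> {}"
proof
  assume "K = {}"
  then have "conjugate (indicator_fun K) s = -\<infinity>"
    by (simp add: conjugate_def indicator_fun_def)
  then show False using assms by simp
qed

lemma norm_projection_residual_le:
  fixes K :: "'a::euclidean_space set"
  assumes K: "closed K" "convex K"
    and v: "x - v \<in> subdiff (conjugate (indicator_fun K)) (- y)"
  shows "norm (x - closest_point K (x - y)) \<le> norm v"
proof (rule norm_resolvent_residual_le[OF v])
  have ne: "K \<noteq> {}"
    using v indicator_conjugate_finite_nonempty[of K "- y"] by (auto simp: subdiff_def)
  define p where "p = x - y"
  have "p - closest_point K p \<in> subdiff (indicator_fun K) (closest_point K p)"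
    using closest_point_in_set[OF K(1) ne] closest_point_dot[OF K(2,1)]
    by (auto simp: subdiff_def indicator_fun_def)
  then show "closest_point K (x - y) \<in> subdiff (conjugate (indicator_fun K)) (x - y - closest_point K (x - y))"
    unfolding p_def by (rule subdiff_conjugate_of_subdiff)
qed

lemma closed_convex_box_set:
  fixes l u :: "'m::finite \<Rightarrow> ereal"
  shows "closed (box_set l u)" "convex (box_set l u)"
proof -
  have eq: "box_set l u = (\<Inter>i. {y. l i \<le> ereal (y $ i)} \<inter> {y. ereal (y $ i) \<le> u i})"
    by (auto simp: box_set_def)
  have lower: "closed {y :: real^'m. r \<le> ereal (y $ i)} \<and> convex {y :: real^'m. r \<le> ereal (y $ i)}"
    for r i
    using convex_halfspace_ge[of _ "axis i 1 :: real^'m"]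
    by (cases r) (auto simp: closed_halfspace_component_ge_cart inner_axis')
  have upper: "closed {y :: real^'m. ereal (y $ i) \<le> r} \<and> convex {y :: real^'m. ereal (y $ i) \<le> r}"
    for r i
    using convex_halfspace_le[of "axis i 1 :: real^'m"]
    by (cases r) (auto simp: closed_halfspace_component_le_cart inner_axis')
  show "closed (box_set l u)" "convex (box_set l u)"
    unfolding eq using lower upper
    by (auto intro!: closed_INT closed_Int convex_INT convex_Int)
qed

section \<open>Seminorms and the Halpern iteration\<close>

lemma seminorm_nonneg: "psd_op M \<Longrightarrow> 0 \<le> seminorm M x"
  by (simp add: seminorm_def psd_op_nonneg)

lemma seminorm_sq: "psd_op M \<Longrightarrow> (seminorm M x)\<^sup>2 = x \<bullet> M x"
  by (simp add: seminorm_def psd_op_nonneg)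

lemma psd_inner_le_seminorm:
  assumes "psd_op M"
  shows "x \<bullet> M y \<le> seminorm M x * seminorm M y"
proof -
  have "(x \<bullet> M y)\<^sup>2 \<le> (x \<bullet> M x) * (y \<bullet> M y)"
    using form_Cauchy_Schwarz[OF psd_op_linear[OF assms] psd_op_sym[OF assms] subspace_UNIV]
      psd_op_nonneg[OF assms] by simp
  then have "x \<bullet> M y \<le> sqrt ((x \<bullet> M x) * (y \<bullet> M y))" by (rule real_le_rsqrt)
  then show ?thesis by (simp add: seminorm_def real_sqrt_mult)
qed

lemma seminorm_scale: "psd_op M \<Longrightarrow> seminorm M (r *\<^sub>R x) = \<bar>r\<bar> * seminorm M x"
  by (simp add: seminorm_def linear_scale[OF psd_op_linear] real_sqrt_mult flip: mult.assoc)

lemma seminorm_triangle: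
  assumes M: "psd_op M"
  shows "seminorm M (x + y) \<le> seminorm M x + seminorm M y"
proof (rule power2_le_imp_le)
  have "(seminorm M (x + y))\<^sup>2 = x \<bullet> M x + 2 * (x \<bullet> M y) + y \<bullet> M y"
    unfolding seminorm_sq[OF M] using psd_op_sym[OF M, of y x]
    by (simp add: linear_add[OF psd_op_linear[OF M]] inner_add_left inner_add_right inner_commute)
  also have "\<dots> \<le> (seminorm M x + seminorm M y)\<^sup>2"
    using psd_inner_le_seminorm[OF M, of x y]
    by (simp add: power2_sum seminorm_sq[OF M] mult.assoc)
  finally show "(seminorm M (x + y))\<^sup>2 \<le> (seminorm M x + seminorm M y)\<^sup>2" .
qed (simp add: seminorm_nonneg[OF M])

lemma seminorm_minus: "psd_op M \<Longrightarrow> seminorm M (x - y) = seminorm M (y - x)"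
  using seminorm_scale[of M "-1" "x - y"] by simp

text \<open>
  The scalar identity behind the descent of the Halpern potential. With \<open>g, g'\<close> two consecutive
  residuals \<open>u - ub\<close> and \<open>e, e'\<close> the corresponding displacements from the anchor \<open>u 0\<close>, the
  variables are the products \<open>p = \<langle>e', g'\<rangle>\<close>, \<open>q = \<langle>e', g\<rangle>\<close>, \<open>r = \<langle>e, g'\<rangle>\<close>, \<open>s = \<langle>e, g\<rangle>\<close>,
  \<open>a = \<langle>g', g'\<rangle>\<close>, \<open>b = \<langle>g, g'\<rangle>\<close>, \<open>d = \<langle>g, g\<rangle>\<close>, and \<open>n = k + 1\<close>. The first hypothesis is
  monotonicity between the two iterates; multiplied by \<open>n (n + 1)\<close> it becomes the conclusion.
\<close>

lemma Halpern_potential_step: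
  fixes n :: real
  assumes firm: "0 \<le> p - q - r + s - a + 2 * b - d" and n: "n > 0"
    and p: "p = (n / (n + 1)) * (r - 2 * b)" and q: "q = (n / (n + 1)) * (s - 2 * d)"
  shows "n * (n + 1) * a + (n + 1) * p \<le> (n - 1) * n * d + n * s"
proof -
  have r: "n * r = (n + 1) * p + 2 * n * b" and q': "(n + 1) * q = n * (s - 2 * d)"
    using n by (auto simp: p q field_simps)
  have "0 \<le> n * (n + 1) * (p - q - r + s - a + 2 * b - d)"
    using firm n by simp
  also have "\<dots> = n * (n + 1) * (p + s - a + 2 * b - d) - n * ((n + 1) * q) - (n + 1) * (n * r)"
    by (simp add: algebra_simps)
  also have "\<dots> = (n - 1) * n * d + n * s - (n * (n + 1) * a + (n + 1) * p)"
    unfolding r q' by (simp add: algebra_simps)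
  finally show ?thesis by simp
qed

text \<open>
  The potential \<open>k (k + 1) \<parallel>g k\<parallel>\<^sup>2 + (k + 1) \<langle>u k - u 0, g k\<rangle>\<close>, with \<open>g k = u k - ub (k + 1)\<close>, starts
  at \<open>0\<close> and decreases. Its nonpositivity together with the monotonicity inequality against the
  solution \<open>us\<close> gives \<open>(k + 1) \<parallel>g k\<parallel>\<^sup>2 \<le> \<langle>u 0 - us, g k\<rangle>\<close>, and Cauchy-Schwarz finishes. The second
  claim holds because reflection does not increase the distance to \<open>us\<close>: an iterate is a convex
  combination of the anchor and of a reflected point, and \<open>ub (k + 1)\<close> is the midpoint of \<open>u k\<close> and
  its reflection.
\<close>

lemma Halpern_rate:
  fixes M :: "'a::euclidean_space \<Rightarrow> 'a"
  assumes M: "psd_op M"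
    and step: "\<And>k. u (Suc k) = (1 / (real k + 2)) *\<^sub>R u 0
      + ((real k + 1) / (real k + 2)) *\<^sub>R (2 *\<^sub>R ub (Suc k) - u k)"
    and mono: "\<And>j k. 0 \<le> (ub (Suc j) - ub (Suc k)) \<bullet> (M (u j - ub (Suc j)) - M (u k - ub (Suc k)))"
    and sol: "\<And>k. 0 \<le> (ub (Suc k) - us) \<bullet> M (u k - ub (Suc k))"
  shows "seminorm M (ub (Suc k) - u k) \<le> seminorm M (u 0 - us) / (real k + 1)"
    and "seminorm M (ub (Suc k) - us) \<le> seminorm M (u 0 - us)"
proof -
  note lin = psd_op_linear[OF M]
  define g where "g = (\<lambda>k. u k - ub (Suc k))"
  define e where "e = (\<lambda>k. u k - u 0)"
  define V where "V = (\<lambda>k. real k * (real k + 1) * (g k \<bullet> M (g k)) + (real k + 1) * (e k \<bullet> M (g k)))"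
  have V_le: "V (Suc k) \<le> V k" for k
  proof -
    define n where "n = real k + 1"
    have e': "e (Suc k) = (n / (n + 1)) *\<^sub>R (e k - 2 *\<^sub>R g k)"
    proof -
      define \<alpha> where "\<alpha> = n / (n + 1)"
      have "1 / (real k + 2) = 1 - \<alpha>" "(real k + 1) / (real k + 2) = \<alpha>"
        by (auto simp: \<alpha>_def n_def field_simps)
      then have "u (Suc k) = (1 - \<alpha>) *\<^sub>R u 0 + \<alpha> *\<^sub>R (2 *\<^sub>R ub (Suc k) - u k)"
        using step[of k] by simp
      then show ?thesis
        unfolding \<alpha>_def[symmetric] by (simp add: e_def g_def algebra_simps scaleR_2)
    qed
    have sym: "g k \<bullet> M (g (Suc k)) = g (Suc k) \<bullet> M (g k)"
      by (metis psd_op_sym[OF M] inner_commute)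
    have "n * (n + 1) * (g (Suc k) \<bullet> M (g (Suc k))) + (n + 1) * (e (Suc k) \<bullet> M (g (Suc k)))
        \<le> (n - 1) * n * (g k \<bullet> M (g k)) + n * (e k \<bullet> M (g k))"
    proof (rule Halpern_potential_step)
      have "ub (Suc (Suc k)) - ub (Suc k) = (e (Suc k) - g (Suc k)) - (e k - g k)"
        by (simp add: e_def g_def)
      moreover have "u (Suc k) - ub (Suc (Suc k)) = g (Suc k)" "u k - ub (Suc k) = g k"
        by (simp_all add: g_def)
      ultimately have "0 \<le> ((e (Suc k) - g (Suc k)) - (e k - g k)) \<bullet> (M (g (Suc k)) - M (g k))"
        using mono[of "Suc k" k] by simp
      then show "0 \<le> e (Suc k) \<bullet> M (g (Suc k)) - e (Suc k) \<bullet> M (g k) - e k \<bullet> M (g (Suc k))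
          + e k \<bullet> M (g k) - g (Suc k) \<bullet> M (g (Suc k)) + 2 * (g (Suc k) \<bullet> M (g k)) - g k \<bullet> M (g k)"
        using sym by (simp add: inner_diff_left inner_diff_right algebra_simps)
      show "n > 0" by (simp add: n_def)
      show "e (Suc k) \<bullet> M (g (Suc k)) = (n / (n + 1)) * (e k \<bullet> M (g (Suc k)) - 2 * (g (Suc k) \<bullet> M (g k)))"
        unfolding e' using sym by (simp add: inner_diff_left)
      show "e (Suc k) \<bullet> M (g k) = (n / (n + 1)) * (e k \<bullet> M (g k) - 2 * (g k \<bullet> M (g k)))"
        unfolding e' by (simp add: inner_diff_left)
    qed
    then show ?thesis by (simp add: V_def n_def algebra_simps)
  qed
  have V: "V k \<le> 0" for k
  proof (induction k)
    case 0
    show ?case by (simp add: V_def e_def)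
  next
    case (Suc k)
    then show ?case using V_le[of k] by simp
  qed
  have fejer: "g k \<bullet> M (g k) \<le> (u k - us) \<bullet> M (g k)" for k
    using sol[of k] by (simp add: g_def inner_diff_left)
  show "seminorm M (ub (Suc k) - u k) \<le> seminorm M (u 0 - us) / (real k + 1)"
  proof -
    define S where "S = seminorm M (g k)"
    have "(real k + 1) * (real k * (g k \<bullet> M (g k)) + e k \<bullet> M (g k)) \<le> 0"
      using V[of k] by (simp add: V_def algebra_simps)
    then have "real k * (g k \<bullet> M (g k)) + e k \<bullet> M (g k) \<le> 0"
      by (simp add: mult_le_0_iff)
    then have "(real k + 1) * (g k \<bullet> M (g k)) \<le> (u 0 - us) \<bullet> M (g k)"
      using fejer[of k] by (simp add: e_def inner_diff_left algebra_simps)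
    also have "\<dots> \<le> seminorm M (u 0 - us) * S"
      unfolding S_def by (rule psd_inner_le_seminorm[OF M])
    finally have "((real k + 1) * S) * S \<le> seminorm M (u 0 - us) * S"
      by (simp add: S_def seminorm_sq[OF M, symmetric] power2_eq_square mult.assoc)
    moreover have "0 \<le> S" "0 \<le> seminorm M (u 0 - us)"
      by (simp_all add: S_def seminorm_nonneg[OF M])
    ultimately have "(real k + 1) * S \<le> seminorm M (u 0 - us)"
      by (cases "S = 0") auto
    then show ?thesis
      by (simp add: S_def g_def seminorm_minus[OF M, of "ub (Suc k)"] field_simps)
  qed
  have reflect: "seminorm M (2 *\<^sub>R ub (Suc k) - u k - us) \<le> seminorm M (u k - us)" for k
  proof (rule power2_le_imp_le)
    have eq: "2 *\<^sub>R ub (Suc k) - u k - us = (u k - us) - 2 *\<^sub>R g k"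
      by (simp add: g_def scaleR_2)
    have "g k \<bullet> M (u k - us) = (u k - us) \<bullet> M (g k)"
      by (metis psd_op_sym[OF M] inner_commute)
    moreover define a b d where "a = (u k - us) \<bullet> M (u k - us)" and "b = (u k - us) \<bullet> M (g k)"
      and "d = g k \<bullet> M (g k)"
    ultimately have "(seminorm M (2 *\<^sub>R ub (Suc k) - u k - us))\<^sup>2 = a - 2 * b - 2 * (b - 2 * d)"
      unfolding seminorm_sq[OF M] eq
      by (simp only: linear_diff[OF lin, of "u k - us" "2 *\<^sub>R g k"] linear_scale[OF lin]
          inner_diff_left[of "u k - us"] inner_diff_right inner_scaleR_left inner_scaleR_right)
    moreover have "(seminorm M (u k - us))\<^sup>2 = a" "d \<le> b"
      using fejer[of k] by (simp_all add: seminorm_sq[OF M] a_def b_def d_def)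
    ultimately show "(seminorm M (2 *\<^sub>R ub (Suc k) - u k - us))\<^sup>2 \<le> (seminorm M (u k - us))\<^sup>2"
      by simp
  qed (simp add: seminorm_nonneg[OF M])
  have dist: "seminorm M (u k - us) \<le> seminorm M (u 0 - us)" for k
  proof (induction k)
    case (Suc k)
    define \<alpha> where "\<alpha> = 1 / (real k + 2)"
    have \<alpha>: "0 \<le> \<alpha>" "\<alpha> \<le> 1" "(real k + 1) / (real k + 2) = 1 - \<alpha>"
      by (auto simp: \<alpha>_def field_simps)
    have "u (Suc k) - us = \<alpha> *\<^sub>R (u 0 - us) + (1 - \<alpha>) *\<^sub>R (2 *\<^sub>R ub (Suc k) - u k - us)"
      unfolding step[of k] \<alpha>(3) by (simp add: \<alpha>_def[symmetric] algebra_simps)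
    then have "seminorm M (u (Suc k) - us)
        \<le> \<alpha> * seminorm M (u 0 - us) + (1 - \<alpha>) * seminorm M (2 *\<^sub>R ub (Suc k) - u k - us)"
      using seminorm_triangle[OF M, of "\<alpha> *\<^sub>R (u 0 - us)"
          "(1 - \<alpha>) *\<^sub>R (2 *\<^sub>R ub (Suc k) - u k - us)"] \<alpha>
      by (simp add: seminorm_scale[OF M])
    also have "\<dots> \<le> \<alpha> * seminorm M (u 0 - us) + (1 - \<alpha>) * seminorm M (u 0 - us)"
      using reflect[of k] Suc.IH \<alpha> by (intro add_left_mono mult_left_mono) auto
    finally show ?case by (simp add: algebra_simps)
  qed simp
  show "seminorm M (ub (Suc k) - us) \<le> seminorm M (u 0 - us)"
  proof -
    have "ub (Suc k) - us = (1/2) *\<^sub>R (2 *\<^sub>R ub (Suc k) - u k - us) + (1/2) *\<^sub>R (u k - us)"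
      by (simp add: algebra_simps flip: scaleR_add_left)
    then have "seminorm M (ub (Suc k) - us)
        \<le> (1/2) * seminorm M (2 *\<^sub>R ub (Suc k) - u k - us) + (1/2) * seminorm M (u k - us)"
      using seminorm_triangle[OF M] by (metis (no_types, lifting) seminorm_scale[OF M] abs_of_pos half_gt_zero zero_less_one)
    then show ?thesis using reflect[of k] dist[of k] by linarith
  qed
qed

section \<open>The proximal metric\<close>

text \<open>
  The metric \<open>M\<close> of a proximal augmented Lagrangian step with constraint operator \<open>B\<close> and proximal
  term \<open>S\<close>, arranged so that the vector \<open>\<sigma> B p + x\<close> is visible: the quadratic form is
  \<open>\<parallel>\<sigma> B p + x\<parallel>\<^sup>2 / \<sigma> + \<langle>p, S p\<rangle>\<close>.
\<close>

definition prox_metric ::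
  "('p::euclidean_space \<Rightarrow> 'x::euclidean_space) \<Rightarrow> ('p \<Rightarrow> 'p) \<Rightarrow> real
    \<Rightarrow> 'p \<times> 'z::euclidean_space \<times> 'x \<Rightarrow> 'p \<times> 'z \<times> 'x" where
  "prox_metric B S \<sigma> = (\<lambda>(p, z, x).
     (adjoint B (\<sigma> *\<^sub>R B p + x) + S p, 0, (1 / \<sigma>) *\<^sub>R (\<sigma> *\<^sub>R B p + x)))"

context
  fixes B :: "'p::euclidean_space \<Rightarrow> 'x::euclidean_space" and S :: "'p \<Rightarrow> 'p" and \<sigma> :: real
  assumes B: "linear B" and S: "psd_op S" and \<sigma>: "\<sigma> > 0"
begin

lemma inner_prox_metric:
  "(p, z, x) \<bullet> prox_metric B S \<sigma> (p', z', x')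
    = \<sigma> * (B p \<bullet> B p') + B p \<bullet> x' + x \<bullet> B p' + x \<bullet> x' / \<sigma> + p \<bullet> S p'"
  using \<sigma> by (simp add: prox_metric_def inner_add_right adjoint_works[OF B] field_simps)

lemma prox_metric_sq:
  "(p, z, x) \<bullet> prox_metric B S \<sigma> (p, z, x) = (norm (\<sigma> *\<^sub>R B p + x))\<^sup>2 / \<sigma> + p \<bullet> S p"
proof -
  have "(norm (\<sigma> *\<^sub>R B p + x))\<^sup>2 / \<sigma> = \<sigma> * (B p \<bullet> B p) + 2 * (B p \<bullet> x) + x \<bullet> x / \<sigma>"
    unfolding power2_norm_eq_inner using \<sigma> inner_commute[of x "B p"]
    by (simp add: inner_add_left inner_add_right field_simps)
  then show ?thesis
    unfolding inner_prox_metric using inner_commute[of x "B p"] by simp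
qed

lemma psd_prox_metric: "psd_op (prox_metric B S \<sigma> :: 'p \<times> 'z::euclidean_space \<times> 'x \<Rightarrow> _)"
proof (rule psd_opI)
  note S_lin = psd_op_linear[OF S]
  note lins = linear_add[OF B] linear_scale[OF B] linear_add[OF S_lin] linear_scale[OF S_lin]
    linear_add[OF adjoint_linear[OF B]] linear_scale[OF adjoint_linear[OF B]]
  show "linear (prox_metric B S \<sigma> :: 'p \<times> 'z \<times> 'x \<Rightarrow> _)"
    by (rule linearI) (auto simp: prox_metric_def lins algebra_simps)
  show "a \<bullet> prox_metric B S \<sigma> b = prox_metric B S \<sigma> a \<bullet> b" for a b :: "'p \<times> 'z \<times> 'x"
  proof -
    obtain p z x p' z' x' where ab: "a = (p, z, x)" "b = (p', z', x')" by (cases a; cases b) auto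
    have "p \<bullet> S p' = p' \<bullet> S p" by (metis psd_op_sym[OF S] inner_commute)
    then have "a \<bullet> prox_metric B S \<sigma> b = b \<bullet> prox_metric B S \<sigma> a"
      unfolding ab inner_prox_metric
      using inner_commute[of "B p" "B p'"] inner_commute[of "B p" x'] inner_commute[of x "B p'"]
        inner_commute[of x x'] by simp
    then show ?thesis by (metis inner_commute)
  qed
  show "0 \<le> a \<bullet> prox_metric B S \<sigma> a" for a :: "'p \<times> 'z \<times> 'x"
  proof -
    obtain p z x where a: "a = (p, z, x)" by (cases a) auto
    have "a \<bullet> prox_metric B S \<sigma> a = (norm (\<sigma> *\<^sub>R B p + x))\<^sup>2 / \<sigma> + p \<bullet> S p"
      unfolding a by (rule prox_metric_sq)
    then show ?thesis using \<sigma> psd_op_nonneg[OF S] by simp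
  qed
qed

lemma seminorm_prox_metric_ge:
  shows "norm (\<sigma> *\<^sub>R B p + x) \<le> sqrt \<sigma> * seminorm (prox_metric B S \<sigma>) (p, z, x)"
    and "seminorm S p \<le> seminorm (prox_metric B S \<sigma>) (p, z, x)"
proof -
  have "(norm (\<sigma> *\<^sub>R B p + x))\<^sup>2 \<le> \<sigma> * ((p, z, x) \<bullet> prox_metric B S \<sigma> (p, z, x))"
    unfolding prox_metric_sq using \<sigma> psd_op_nonneg[OF S, of p] by (simp add: field_simps)
  then have "norm (\<sigma> *\<^sub>R B p + x) \<le> sqrt (\<sigma> * ((p, z, x) \<bullet> prox_metric B S \<sigma> (p, z, x)))"
    by (rule real_le_rsqrt)
  then show "norm (\<sigma> *\<^sub>R B p + x) \<le> sqrt \<sigma> * seminorm (prox_metric B S \<sigma>) (p, z, x)"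
    by (simp add: seminorm_def real_sqrt_mult)
  show "seminorm S p \<le> seminorm (prox_metric B S \<sigma>) (p, z, x)"
    unfolding seminorm_def prox_metric_sq using \<sigma> by simp
qed

lemma norm_prox_metric_multiplier_le:
  "norm (snd (snd (prox_metric B S \<sigma> d))) \<le> seminorm (prox_metric B S \<sigma>) d / sqrt \<sigma>"
proof -
  obtain p z x where d: "d = (p, z, x)" by (cases d) auto
  define N where "N = seminorm (prox_metric B S \<sigma>) (p, z, x)"
  have "norm (\<sigma> *\<^sub>R B p + x) \<le> sqrt \<sigma> * N"
    unfolding N_def by (rule seminorm_prox_metric_ge)
  then have "norm (\<sigma> *\<^sub>R B p + x) / \<sigma> \<le> sqrt \<sigma> * N / \<sigma>"
    using \<sigma> by (simp add: divide_right_mono)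
  also have "\<dots> = N / sqrt \<sigma>"
    using \<sigma> by (simp add: field_simps flip: mult.assoc)
  finally show ?thesis
    unfolding d N_def[symmetric] using \<sigma> by (simp add: prox_metric_def)
qed

text \<open>
  The two summands of the quadratic form control \<open>\<sigma> B p + x\<close>, through which \<open>B\<close> and \<open>x\<close> enter, and
  \<open>S p\<close>, which costs one factor \<open>\<parallel>sqrt S\<parallel>\<close>.
\<close>

lemma norm_prox_metric_le:
  "norm (prox_metric B S \<sigma> d)
    \<le> ((\<sigma> * onorm (adjoint B) + 1) / sqrt \<sigma> + onorm (op_sqrt S)) * seminorm (prox_metric B S \<sigma>) d"
proof -
  obtain p z x where d: "d = (p, z, x)" by (cases d) auto
  define t where "t = \<sigma> *\<^sub>R B p + x"
  define N where "N = seminorm (prox_metric B S \<sigma>) d"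
  have t: "norm t \<le> sqrt \<sigma> * N"
    unfolding t_def N_def d by (rule seminorm_prox_metric_ge)
  have bl: "bounded_linear (adjoint B)"
    using adjoint_linear[OF B] by (simp add: linear_conv_bounded_linear)
  have o: "0 \<le> onorm (adjoint B)" by (rule onorm_pos_le[OF bl])
  have oS: "0 \<le> onorm (op_sqrt S)"
    using op_sqrt(1)[OF S] by (intro onorm_pos_le) (simp add: psd_op_def linear_conv_bounded_linear)
  have "norm (prox_metric B S \<sigma> d) \<le> norm (adjoint B t + S p) + norm ((1 / \<sigma>) *\<^sub>R t)"
    using norm_Pair_le[of "adjoint B t + S p" "(0, (1 / \<sigma>) *\<^sub>R t)"]
    by (simp add: d prox_metric_def t_def norm_Pair1)
  also have "\<dots> \<le> norm (adjoint B t) + norm (S p) + norm ((1 / \<sigma>) *\<^sub>R t)"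
    by (simp add: norm_triangle_ineq)
  also have "\<dots> \<le> onorm (adjoint B) * norm t + onorm (op_sqrt S) * N + norm t / \<sigma>"
  proof -
    have "norm (S p) \<le> onorm (op_sqrt S) * seminorm S p" by (rule norm_psd_op_le[OF S])
    also have "\<dots> \<le> onorm (op_sqrt S) * N"
      unfolding N_def d by (intro mult_left_mono seminorm_prox_metric_ge oS)
    finally have "norm (S p) \<le> onorm (op_sqrt S) * N" .
    then show ?thesis using onorm[OF bl, of t] \<sigma> by simp
  qed
  also have "\<dots> = (onorm (adjoint B) + 1 / \<sigma>) * norm t + onorm (op_sqrt S) * N"
    by (simp add: algebra_simps)
  also have "\<dots> \<le> (onorm (adjoint B) + 1 / \<sigma>) * (sqrt \<sigma> * N) + onorm (op_sqrt S) * N"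
    using t o \<sigma> by (intro add_right_mono mult_left_mono) auto
  also have "(onorm (adjoint B) + 1 / \<sigma>) * (sqrt \<sigma> * N) = (\<sigma> * onorm (adjoint B) + 1) / sqrt \<sigma> * N"
  proof -
    have "sqrt \<sigma> * sqrt \<sigma> = \<sigma>" "sqrt \<sigma> > 0" using \<sigma> by simp_all
    then have "(onorm (adjoint B) + 1 / \<sigma>) * sqrt \<sigma> = (\<sigma> * onorm (adjoint B) + 1) / sqrt \<sigma>"
      using \<sigma> by (simp add: field_simps)
    then show ?thesis by (simp flip: mult.assoc)
  qed
  finally show ?thesis by (simp add: N_def distrib_right)
qed

end

lemma linear_AQ: "linear Q \<Longrightarrow> linear A \<Longrightarrow> linear (AQ Q A)"
  by (rule linearI)
    (auto simp: AQ_def linear_add linear_scale adjoint_linear linear_add[OF adjoint_linear]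
      linear_scale[OF adjoint_linear] algebra_simps)

lemma adjoint_AQ:
  fixes A :: "real^'n::finite \<Rightarrow> real^'m::finite"
  assumes Q: "psd_op Q" and A: "linear A"
  shows "adjoint (AQ Q A) = (\<lambda>x. (A x, - Q x))"
proof (rule adjoint_unique, intro allI)
  fix p :: "(real^'m) \<times> (real^'n)" and x :: "real^'n"
  obtain y w where p: "p = (y, w)" by (cases p)
  have "adjoint A y \<bullet> x = y \<bullet> A x" by (simp add: adjoint_clauses[OF A])
  moreover have "Q w \<bullet> x = w \<bullet> Q x" by (simp add: psd_op_sym[OF Q])
  ultimately show "AQ Q A p \<bullet> x = p \<bullet> (A x, - Q x)"
    by (simp add: p AQ_def inner_diff_left)
qed

text \<open>
  The kernel of a self-adjoint operator is the orthogonal complement of its range, so the range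
  component of \<open>a\<close> has the same image as \<open>a\<close>.
\<close>

lemma range_psd_op_preimage:
  fixes T :: "'a::euclidean_space \<Rightarrow> 'a"
  assumes T: "psd_op T"
  obtains v where "v \<in> range T" "T v = T a"
proof -
  note lin = psd_op_linear[OF T]
  have "subspace (range T)" using lin by (simp add: linear_subspace_image)
  then obtain r n where r: "r \<in> range T" and n: "\<And>w. w \<in> range T \<Longrightarrow> orthogonal n w" and a: "a = r + n"
    by (metis orthogonal_subspace_decomp_exists span_eq_iff)
  have "T n \<bullet> T n = n \<bullet> T (T n)" using psd_op_sym[OF T] by simp
  also have "\<dots> = 0" using n[of "T (T n)"] by (simp add: orthogonal_def)
  finally have "T r = T a" by (simp add: a linear_add[OF lin])
  with r show ?thesis by (rule that)
qed

text \<open>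
  On the range of \<open>Q\<close> the inverted operator is \<open>(1 + \<sigma> lam) Q\<close>. The value of the inverse at \<open>Q a\<close> is
  used only after another application of \<open>Q\<close>, which makes it independent of the chosen preimage.
\<close>

lemma S_sGS_eq:
  assumes Q: "psd_op Q" and A: "linear A" and pos: "\<sigma> > 0" "lam > 0"
  shows "S_sGS Q A \<sigma> (\<lambda>v. Q (lam *\<^sub>R v - Q v))
    = (\<lambda>(y, w). ((\<sigma>\<^sup>2 / (1 + \<sigma> * lam)) *\<^sub>R A (Q (adjoint A y)), 0))"
proof -
  note Ql = psd_op_linear[OF Q]
  have c: "1 + \<sigma> * lam > 0" using pos by (simp add: add_pos_pos)
  define G where "G = (\<lambda>v. \<sigma> *\<^sub>R Q (Q v) + Q v + \<sigma> *\<^sub>R Q (lam *\<^sub>R v - Q v))"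
  have G: "G v = (1 + \<sigma> * lam) *\<^sub>R Q v" for v
    by (simp add: G_def linear_diff[OF Ql] linear_scale[OF Ql] algebra_simps)
  have "Q (inv_into (range Q) G (Q a)) = (1 / (1 + \<sigma> * lam)) *\<^sub>R Q a" for a
  proof -
    obtain v where v: "v \<in> range Q" "Q v = Q a" by (rule range_psd_op_preimage[OF Q])
    define v' where "v' = (1 / (1 + \<sigma> * lam)) *\<^sub>R v"
    have "v' \<in> range Q" using v(1) by (auto simp: v'_def linear_scale[OF Ql, symmetric])
    moreover have "G v' = Q a" using c v(2) by (simp add: G v'_def linear_scale[OF Ql])
    ultimately have "Q a \<in> G ` range Q" by (metis imageI)
    then have "G (inv_into (range Q) G (Q a)) = Q a" by (rule f_inv_into_f)
    then have "(1 / (1 + \<sigma> * lam)) *\<^sub>R Q a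
        = (1 / (1 + \<sigma> * lam)) *\<^sub>R ((1 + \<sigma> * lam) *\<^sub>R Q (inv_into (range Q) G (Q a)))"
      by (simp add: G)
    then show ?thesis using c by simp
  qed
  then show ?thesis
    unfolding S_sGS_def G_def[symmetric] by (simp add: linear_scale[OF A] fun_eq_iff)
qed

lemma psd_S_plus_sGS:
  assumes Q: "psd_op Q" and A: "linear A" and Sy: "psd_op Sy"
    and pos: "\<sigma> > 0" "lam > 0" and lam: "largest_eigenvalue Q \<le> lam"
  defines "Sw \<equiv> \<lambda>v. Q (lam *\<^sub>R v - Q v)"
  shows "psd_op (\<lambda>p. S_op \<sigma> Sy Sw p + S_sGS Q A \<sigma> Sw p)"
proof -
  note Ql = psd_op_linear[OF Q] and Syl = psd_op_linear[OF Sy]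
  have c: "1 + \<sigma> * lam > 0" using pos by (simp add: add_pos_pos)
  have eq: "(\<lambda>p. S_op \<sigma> Sy Sw p + S_sGS Q A \<sigma> Sw p)
    = (\<lambda>(y, w). (\<sigma> *\<^sub>R Sy y + (\<sigma>\<^sup>2 / (1 + \<sigma> * lam)) *\<^sub>R A (Q (adjoint A y)),
        \<sigma> *\<^sub>R (lam *\<^sub>R Q w - Q (Q w))))"
    unfolding Sw_def S_sGS_eq[OF Q A pos]
    by (auto simp: S_op_def linear_diff[OF Ql] linear_scale[OF Ql])
  note lins = linear_add[OF Ql] linear_scale[OF Ql] linear_add[OF Syl] linear_scale[OF Syl]
    linear_add[OF A] linear_scale[OF A]
    linear_add[OF adjoint_linear[OF A]] linear_scale[OF adjoint_linear[OF A]]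
  have form: "(y, w) \<bullet> (\<sigma> *\<^sub>R Sy y' + (\<sigma>\<^sup>2 / (1 + \<sigma> * lam)) *\<^sub>R A (Q (adjoint A y')),
        \<sigma> *\<^sub>R (lam *\<^sub>R Q w' - Q (Q w')))
    = \<sigma> * (y \<bullet> Sy y') + (\<sigma>\<^sup>2 / (1 + \<sigma> * lam)) * (adjoint A y \<bullet> Q (adjoint A y'))
      + \<sigma> * (lam * (w \<bullet> Q w') - Q w \<bullet> Q w')" for y y' w w'
    using psd_op_sym[OF Q, of w "Q w'"]
    by (simp add: inner_add_right inner_diff_right adjoint_clauses[OF A])
  show ?thesis
    unfolding eq
  proof (rule psd_opI)
    let ?T = "\<lambda>(y, w). (\<sigma> *\<^sub>R Sy y + (\<sigma>\<^sup>2 / (1 + \<sigma> * lam)) *\<^sub>R A (Q (adjoint A y)),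
        \<sigma> *\<^sub>R (lam *\<^sub>R Q w - Q (Q w)))"
    show "linear ?T"
      by (rule linearI) (auto simp: lins algebra_simps)
    show "a \<bullet> ?T b = ?T a \<bullet> b" for a b
    proof -
      obtain y w y' w' where ab: "a = (y, w)" "b = (y', w')" by (cases a; cases b)
      have sSy: "y \<bullet> Sy y' = y' \<bullet> Sy y" by (metis psd_op_sym[OF Sy] inner_commute)
      have sQ: "v \<bullet> Q v' = v' \<bullet> Q v" for v v' by (metis psd_op_sym[OF Q] inner_commute)
      have "a \<bullet> ?T b = b \<bullet> ?T a"
        unfolding ab prod.case form
        by (simp only: sSy inner_commute[of "Q w" "Q w'"] sQ[of w w'] sQ[of "adjoint A y" "adjoint A y'"])
      also have "b \<bullet> ?T a = ?T a \<bullet> b" by (rule inner_commute)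
      finally show ?thesis .
    qed
    show "0 \<le> a \<bullet> ?T a" for a
    proof -
      obtain y w where a: "a = (y, w)" by (cases a)
      have "0 \<le> lam * (w \<bullet> Q w) - Q w \<bullet> Q w"
        using norm_sq_psd_op_le[OF Q lam, of w] by simp
      then show ?thesis
        unfolding a prod.case form using pos c psd_op_nonneg[OF Sy] psd_op_nonneg[OF Q]
        by (intro add_nonneg_nonneg mult_nonneg_nonneg) auto
    qed
  qed
qed

lemma M_op_eq_prox_metric:
  fixes A :: "real^'n::finite \<Rightarrow> real^'m::finite"
  assumes "linear Q" "linear A" "\<sigma> > 0"
  shows "M_op Q A \<sigma> Sy Sw = prox_metric (AQ Q A) (\<lambda>p. S_op \<sigma> Sy Sw p + S_sGS Q A \<sigma> Sw p) \<sigma>"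
proof
  fix d :: "('m, 'n) point"
  obtain p z x where d: "d = (p, z, x)" by (metis surj_pair)
  note adj = adjoint_linear[OF linear_AQ[OF assms(1,2)]]
  show "M_op Q A \<sigma> Sy Sw d = prox_metric (AQ Q A) (\<lambda>p. S_op \<sigma> Sy Sw p + S_sGS Q A \<sigma> Sw p) \<sigma> d"
    unfolding d M_op_def prox_metric_def prod.case linear_add[OF adj] linear_scale[OF adj]
    using assms(3) by (simp add: scaleR_add_right add_ac)
qed

section \<open>The KKT operator\<close>

text \<open>
  The saddle operator of the Lagrangian of the dual problem: the subdifferential in \<open>(y, w, z)\<close> and
  the negative gradient in the multiplier \<open>x\<close>. The memberships are stated for the conjugates at \<open>- y\<close>
  and \<open>- z\<close>, which flips the sign of the subgradients.
\<close>

definition KKT_op ::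
  "(real^'n \<Rightarrow> real^'n) \<Rightarrow> real^'n \<Rightarrow> (real^'n \<Rightarrow> ereal) \<Rightarrow> (real^'n \<Rightarrow> real^'m)
    \<Rightarrow> (real^'m) set \<Rightarrow> ('m::finite, 'n::finite) point \<Rightarrow> ('m, 'n) point set" where
  "KKT_op Q c \<phi> A K = (\<lambda>((y, w), z, x). {((vy, vw), vz, vx).
      A x - vy \<in> subdiff (conjugate (indicator_fun K)) (- y)
    \<and> vw = Q w - Q x
    \<and> x - vz \<in> subdiff (conjugate \<phi>) (- z)
    \<and> vx = - dual_res Q c A y w z})"

lemma zero_in_KKT_op:
  assumes "is_KKT Q c \<phi> A K u"
  shows "0 \<in> KKT_op Q c \<phi> A K u"
  using assms by (auto simp: is_KKT_def KKT_op_def dual_res_def zero_prod_def)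

lemma KKT_op_monotone:
  assumes Q: "psd_op Q" and A: "linear A"
    and v: "v \<in> KKT_op Q c \<phi> A K u" and v': "v' \<in> KKT_op Q c \<phi> A K u'"
  shows "0 \<le> (u - u') \<bullet> (v - v')"
proof -
  obtain y w z x vy vw vz vx where u: "u = ((y, w), z, x)" "v = ((vy, vw), vz, vx)"
    by (metis surj_pair)
  obtain y' w' z' x' vy' vw' vz' vx' where u': "u' = ((y', w'), z', x')" "v' = ((vy', vw'), vz', vx')"
    by (metis surj_pair)
  define dy dw dz dx where "dy = y - y'" and "dw = w - w'" and "dz = z - z'" and "dx = x - x'"
  have "A x - vy \<in> subdiff (conjugate (indicator_fun K)) (- y)"
    "A x' - vy' \<in> subdiff (conjugate (indicator_fun K)) (- y')"
    "x - vz \<in> subdiff (conjugate \<phi>) (- z)" "x' - vz' \<in> subdiff (conjugate \<phi>) (- z')"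
    using v v' by (simp_all add: u u' KKT_op_def)
  then have sub: "0 \<le> ((A x - vy) - (A x' - vy')) \<bullet> (- y - - y')"
    "0 \<le> ((x - vz) - (x' - vz')) \<bullet> (- z - - z')"
    by (auto intro: subdiff_monotone simp only:)
  have vx: "vx - vx' = Q dw - adjoint A dy - dz" and vw: "vw - vw' = Q dw - Q dx"
    using v v'
    by (auto simp: u u' KKT_op_def dual_res_def dy_def dw_def dz_def dx_def
        linear_diff[OF adjoint_linear[OF A]] linear_diff[OF psd_op_linear[OF Q]])
  have "0 \<le> (vy - vy' - A dx) \<bullet> dy" "0 \<le> (vz - vz' - dx) \<bullet> dz"
    using sub by (simp_all add: dy_def dz_def dx_def linear_diff[OF A] inner_diff_left inner_diff_right)
  then have 1: "dy \<bullet> A dx \<le> dy \<bullet> (vy - vy')" and 2: "dx \<bullet> dz \<le> dz \<bullet> (vz - vz')"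
    by (simp_all add: inner_diff_left inner_diff_right inner_commute)
  have 3: "dw \<bullet> (vw - vw') = dw \<bullet> Q dw - dx \<bullet> Q dw"
    unfolding vw inner_diff_right by (metis psd_op_sym[OF Q] inner_commute)
  have 4: "dx \<bullet> (vx - vx') = dx \<bullet> Q dw - dy \<bullet> A dx - dx \<bullet> dz"
    unfolding vx inner_diff_right by (metis adjoint_works[OF A] inner_commute)
  have "(u - u') \<bullet> (v - v') = dy \<bullet> (vy - vy') + dw \<bullet> (vw - vw') + dz \<bullet> (vz - vz') + dx \<bullet> (vx - vx')"
    by (simp add: u u' dy_def dw_def dz_def dx_def)
  then show ?thesis
    using 1 2 3 4 psd_op_nonneg[OF Q, of dw] by linarith
qed

lemma norm_KKT_residual_le:
  assumes \<phi>: "proper_fun \<phi>" "closed_fun \<phi>" "convex_fun \<phi>" and K: "closed K" "convex K"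
    and v: "v \<in> KKT_op Q c \<phi> A K u"
  shows "norm (KKT_residual Q c \<phi> A K u) \<le> norm v"
proof -
  obtain y w z x vy vw vz vx where u: "u = ((y, w), z, x)" "v = ((vy, vw), vz, vx)"
    by (metis surj_pair)
  define ry rz where "ry = A x - closest_point K (A x - y)" and "rz = x - prox \<phi> (x - z)"
  have "norm ry \<le> norm vy" "norm rz \<le> norm vz"
    unfolding ry_def rz_def using v
    by (auto simp: u KKT_op_def intro!: norm_projection_residual_le[OF K] norm_prox_residual_le[OF \<phi>])
  then have "(norm ry)\<^sup>2 + (norm rz)\<^sup>2 \<le> (norm vy)\<^sup>2 + (norm vz)\<^sup>2"
    by (intro add_mono power_mono) auto
  moreover have "KKT_residual Q c \<phi> A K u = (ry, vw, rz, vx)"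
    using v by (simp add: u KKT_op_def KKT_residual_def dual_res_def ry_def rz_def)
  ultimately show ?thesis by (simp add: u norm_Pair)
qed

lemma dual_obj_finite:
  assumes "v \<in> KKT_op Q c \<phi> A K ((y, w), z, x)"
  shows "\<bar>dual_obj Q \<phi> K y w z\<bar> \<noteq> \<infinity>"
proof -
  have "\<bar>conjugate (indicator_fun K) (- y)\<bar> \<noteq> \<infinity>" "\<bar>conjugate \<phi> (- z)\<bar> \<noteq> \<infinity>"
    using assms by (auto simp: KKT_op_def subdiff_def)
  then show ?thesis by (auto simp: dual_obj_def)
qed

text \<open>
  The subgradient inequality of the Lagrangian at \<open>(y, w, z, x)\<close>; the pairing with \<open>v\<close> includes the
  multiplier component, which turns the remaining terms into the symmetric difference of the two
  pairings of a multiplier with the residual of the other point. At a solution \<open>v = 0\<close> is admissible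
  and the residual vanishes.
\<close>

lemma dual_obj_ge:
  assumes Q: "psd_op Q" and A: "linear A"
    and v: "v \<in> KKT_op Q c \<phi> A K ((y, w), z, x)"
  shows "dual_obj Q \<phi> K y w z
      + ereal (v \<bullet> (((y', w'), z', x') - ((y, w), z, x))
        + x' \<bullet> dual_res Q c A y w z - x \<bullet> dual_res Q c A y' w' z')
    \<le> dual_obj Q \<phi> K y' w' z'"
proof -
  obtain vy vw vz vx where vv: "v = ((vy, vw), vz, vx)" by (metis surj_pair)
  let ?p = "conjugate (indicator_fun K)" and ?q = "conjugate \<phi>"
  define gy gw gz where "gy = (A x - vy) \<bullet> (y - y')" and "gw = Q w \<bullet> (w' - w)"
    and "gz = (x - vz) \<bullet> (z - z')"
  have sub: "A x - vy \<in> subdiff ?p (- y)" "x - vz \<in> subdiff ?q (- z)"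
    using v by (simp_all add: vv KKT_op_def)
  then obtain p q where p: "?p (- y) = ereal p" and q: "?q (- z) = ereal q"
    by (auto simp: subdiff_def)
  have py: "ereal (p + gy) \<le> ?p (- y')"
  proof -
    have "?p (- y) + ereal ((A x - vy) \<bullet> (- y' - - y)) \<le> ?p (- y')"
      using sub(1) unfolding subdiff_def by blast
    moreover have "- y' - - y = y - y'" by simp
    ultimately show ?thesis by (simp add: p gy_def)
  qed
  have qz: "ereal (q + gz) \<le> ?q (- z')"
  proof -
    have "?q (- z) + ereal ((x - vz) \<bullet> (- z' - - z)) \<le> ?q (- z')"
      using sub(2) unfolding subdiff_def by blast
    moreover have "- z' - - z = z - z'" by simp
    ultimately show ?thesis by (simp add: q gz_def)
  qed
  have qw: "1/2 * (w \<bullet> Q w) + gw \<le> 1/2 * (w' \<bullet> Q w')"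
  proof -
    have "0 \<le> (w' - w) \<bullet> Q (w' - w)" by (rule psd_op_nonneg[OF Q])
    moreover have "w' \<bullet> Q w = Q w \<bullet> w'" "w \<bullet> Q w' = Q w \<bullet> w'" "w \<bullet> Q w = Q w \<bullet> w"
      using psd_op_sym[OF Q] by (simp_all add: inner_commute)
    ultimately show ?thesis
      by (simp add: gw_def linear_diff[OF psd_op_linear[OF Q]] inner_diff_left inner_diff_right)
  qed
  have "v \<bullet> (((y', w'), z', x') - ((y, w), z, x))
        + x' \<bullet> dual_res Q c A y w z - x \<bullet> dual_res Q c A y' w' z' = gy + gw + gz"
  proof -
    define r r' where "r = dual_res Q c A y w z" and "r' = dual_res Q c A y' w' z'"
    have vw: "vw = Q w - Q x" and vx: "vx = - r"
      using v by (auto simp: vv KKT_op_def r_def)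
    have rr: "r' - r = adjoint A (y' - y) - Q (w' - w) + (z' - z)"
      by (simp add: r_def r'_def dual_res_def linear_diff[OF adjoint_linear[OF A]]
          linear_diff[OF psd_op_linear[OF Q]])
    have "x \<bullet> (r' - r) = A x \<bullet> (y' - y) - Q x \<bullet> (w' - w) + x \<bullet> (z' - z)"
      unfolding rr inner_add_right inner_diff_right[of x "adjoint A (y' - y)"]
      using adjoint_works[OF A, of x "y' - y"] psd_op_sym[OF Q, of x "w' - w"] by simp
    then show ?thesis
      unfolding r_def[symmetric] r'_def[symmetric]
      by (simp add: vv vw vx gy_def gw_def gz_def inner_diff_left inner_diff_right inner_commute algebra_simps)
  qed
  then have "dual_obj Q \<phi> K y w z
      + ereal (v \<bullet> (((y', w'), z', x') - ((y, w), z, x))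
        + x' \<bullet> dual_res Q c A y w z - x \<bullet> dual_res Q c A y' w' z')
    = ereal (1/2 * (w \<bullet> Q w) + gw) + ereal (p + gy) + ereal (q + gz)"
    by (simp add: dual_obj_def p q)
  also have "\<dots> \<le> dual_obj Q \<phi> K y' w' z'"
    unfolding dual_obj_def using qw py qz by (intro add_mono) auto
  finally show ?thesis .
qed

section \<open>The algorithm as a proximal point step\<close>

lemma norm_sq_line:
  fixes r d :: "'a::real_inner"
  shows "(norm (r + t *\<^sub>R d))\<^sup>2 = (norm r)\<^sup>2 + t * (2 * (r \<bullet> d)) + t\<^sup>2 * (norm d)\<^sup>2"
  unfolding power2_norm_eq_inner using inner_commute[of d r]
  by (simp add: inner_add_left inner_add_right power2_eq_square algebra_simps)

lemma psd_form_line: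
  assumes "psd_op T"
  shows "(r + t *\<^sub>R d) \<bullet> T (r + t *\<^sub>R d) = r \<bullet> T r + t * (2 * (T r \<bullet> d)) + t\<^sup>2 * (d \<bullet> T d)"
  using psd_op_sym[OF assms, of r d] inner_commute[of d "T r"]
  by (simp add: linear_add[OF psd_op_linear[OF assms]] linear_scale[OF psd_op_linear[OF assms]]
      inner_add_left inner_add_right power2_eq_square algebra_simps)

lemma conjugate_argmin_subgradient:
  fixes f :: "'a::euclidean_space \<Rightarrow> ereal"
  assumes f: "\<And>s. conjugate f s \<noteq> -\<infinity>" "conjugate f s0 \<noteq> \<infinity>"
    and argmin: "is_arg_min (\<lambda>z. conjugate f (- z) + ereal (g z)) (\<lambda>_. True) a"
    and g: "\<And>d t. g (a + t *\<^sub>R d) = g a + t * (l \<bullet> d) + t\<^sup>2 * q d"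
  shows "l \<in> subdiff (conjugate f) (- a)"
proof -
  have "- l \<in> subdiff (\<lambda>z. conjugate f (- z)) a"
    by (rule argmin_subgradient[where ?x0.0 = "- s0", OF convex_fun_reflect[OF convex_fun_conjugate] _ _ argmin g])
      (use f in auto)
  from subdiff_reflect[OF this] show ?thesis by simp
qed

text \<open>
  The first minimization gives \<open>xb \<in> \<partial>\<phi>\<^sup>* (- zb)\<close>. The second gives a subgradient at \<open>- yb\<close> that involves
  the residual \<open>rh\<close> at the half step, and \<open>rh - rb = \<beta> Q A\<^sup>* (yb - y)\<close> with \<open>\<beta> = \<sigma> / (1 + \<sigma> lam)\<close> is
  exactly the contribution of \<open>S_sGS\<close>. The formula for \<open>wb\<close> becomes the proximal optimality condition
  for \<open>w\<close> with term \<open>Sw\<close> after an application of \<open>Q\<close>.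
\<close>

lemma algorithm_B_step:
  fixes A :: "real^'n::finite \<Rightarrow> real^'m::finite" and u ub :: "nat \<Rightarrow> ('m, 'n) point"
  assumes Q: "psd_op Q" and \<phi>: "proper_fun \<phi>" and A: "linear A"
    and KKT: "is_KKT Q c \<phi> A K us"
    and pos: "\<sigma> > 0" "lam > 0" and Sy: "psd_op Sy"
    and alg: "algorithm_B Q c \<phi> A K \<sigma> lam Sy u ub"
  shows "M_op Q A \<sigma> Sy (\<lambda>v. Q (lam *\<^sub>R v - Q v)) (u k - ub (Suc k)) \<in> KKT_op Q c \<phi> A K (ub (Suc k))"
proof -
  obtain y w z x where uk: "u k = ((y, w), z, x)" by (metis surj_pair)
  obtain yb wb zb xb where ubk: "ub (Suc k) = ((yb, wb), zb, xb)" by (metis surj_pair)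
  obtain ys ws zs xs where us: "us = ((ys, ws), zs, xs)" by (metis surj_pair)
  note Ql = psd_op_linear[OF Q] and Al = adjoint_linear[OF A]
  define p q where "p = (\<lambda>y. conjugate (indicator_fun K) (- y))" and "q = (\<lambda>z. conjugate \<phi> (- z))"
  define wh where "wh = (1 / (1 + \<sigma> * lam)) *\<^sub>R ((\<sigma> * lam) *\<^sub>R w + xb + \<sigma> *\<^sub>R dual_res Q c A y w zb)"
  have argz: "is_arg_min (\<lambda>z'. aug_lagrangian Q c A \<sigma> (\<lambda>_. 0) q y w z' x) (\<lambda>_. True) zb"
    and xb: "xb = x + \<sigma> *\<^sub>R dual_res Q c A y w zb"
    and argy: "is_arg_min (\<lambda>y'. aug_lagrangian Q c A \<sigma> p q y' wh zb xb
        + ereal (\<sigma>/2 * (seminorm Sy (y' - y))\<^sup>2)) (\<lambda>_. True) yb"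
    and wb: "wb = (1 / (1 + \<sigma> * lam)) *\<^sub>R ((\<sigma> * lam) *\<^sub>R w + xb + \<sigma> *\<^sub>R dual_res Q c A yb w zb)"
    using alg[unfolded algorithm_B_def, THEN spec[of _ k]]
    unfolding uk ubk p_def q_def wh_def Let_def prod.case by auto
  have finite: "\<bar>conjugate (indicator_fun K) (- ys)\<bar> \<noteq> \<infinity>" "\<bar>conjugate \<phi> (- zs)\<bar> \<noteq> \<infinity>"
    using KKT by (auto simp: us is_KKT_def subdiff_def)
  obtain x0 where x0: "\<phi> x0 \<noteq> \<infinity>" using \<phi> by (auto simp: proper_fun_def)
  obtain k0 where "k0 \<in> K"
    using indicator_conjugate_finite_nonempty[OF finite(1)] by blast
  then have k0: "indicator_fun K k0 \<noteq> \<infinity>" by (simp add: indicator_fun_def)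

  have z_sub: "xb \<in> subdiff (conjugate \<phi>) (- zb)"
  proof (rule conjugate_argmin_subgradient)
    define g where "g = (\<lambda>z'. 1/2 * (w \<bullet> Q w)
      + (x \<bullet> dual_res Q c A y w z' + \<sigma>/2 * (norm (dual_res Q c A y w z'))\<^sup>2))"
    show "conjugate \<phi> s \<noteq> -\<infinity>" for s using x0 by (rule conjugate_not_MInf)
    show "conjugate \<phi> (- zs) \<noteq> \<infinity>" using finite(2) by auto
    have "aug_lagrangian Q c A \<sigma> (\<lambda>_. 0) q y w z' x = conjugate \<phi> (- z') + ereal (g z')" for z'
      unfolding aug_lagrangian_def q_def g_def plus_ereal.simps(1)[symmetric] by (simp add: add_ac)
    then show "is_arg_min (\<lambda>z'. conjugate \<phi> (- z') + ereal (g z')) (\<lambda>_. True) zb"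
      using argz by simp
    have "dual_res Q c A y w (zb + t *\<^sub>R d) = dual_res Q c A y w zb + t *\<^sub>R d" for d t
      by (simp add: dual_res_def)
    then show "g (zb + t *\<^sub>R d) = g zb + t * (xb \<bullet> d) + t\<^sup>2 * (\<sigma>/2 * (norm d)\<^sup>2)" for d t
      unfolding g_def xb by (simp only: norm_sq_line inner_add_left inner_add_right) (simp add: algebra_simps)
  qed
  then obtain qz where qz: "q zb = ereal qz" by (auto simp: subdiff_def q_def)

  define rh rb where "rh = dual_res Q c A yb wh zb" and "rb = dual_res Q c A yb wb zb"
  have y_sub: "A xb + \<sigma> *\<^sub>R A rh + \<sigma> *\<^sub>R Sy (yb - y) \<in> subdiff (conjugate (indicator_fun K)) (- yb)"
  proof (rule conjugate_argmin_subgradient)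
    define g where "g = (\<lambda>y'. 1/2 * (wh \<bullet> Q wh) + qz
      + (xb \<bullet> dual_res Q c A y' wh zb + \<sigma>/2 * (norm (dual_res Q c A y' wh zb))\<^sup>2)
      + \<sigma>/2 * ((y' - y) \<bullet> Sy (y' - y)))"
    show "conjugate (indicator_fun K) s \<noteq> -\<infinity>" for s using k0 by (rule conjugate_not_MInf)
    show "conjugate (indicator_fun K) (- ys) \<noteq> \<infinity>" using finite(1) by auto
    have "aug_lagrangian Q c A \<sigma> p q y' wh zb xb + ereal (\<sigma>/2 * (seminorm Sy (y' - y))\<^sup>2)
        = conjugate (indicator_fun K) (- y') + ereal (g y')" for y'
      unfolding aug_lagrangian_def p_def g_def qz seminorm_sq[OF Sy] plus_ereal.simps(1)[symmetric]
      by (simp only: add_ac)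
    then show "is_arg_min (\<lambda>y'. conjugate (indicator_fun K) (- y') + ereal (g y')) (\<lambda>_. True) yb"
      using argy by simp
    have res: "dual_res Q c A (yb + t *\<^sub>R d) wh zb = rh + t *\<^sub>R adjoint A d" for d t
      by (simp add: dual_res_def rh_def linear_add[OF Al] linear_scale[OF Al])
    have shift: "yb + t *\<^sub>R d - y = (yb - y) + t *\<^sub>R d" for d t by simp
    have AA: "v \<bullet> adjoint A d = A v \<bullet> d" for v d by (rule adjoint_works[OF A])
    show "g (yb + t *\<^sub>R d) = g yb + t * ((A xb + \<sigma> *\<^sub>R A rh + \<sigma> *\<^sub>R Sy (yb - y)) \<bullet> d)
        + t\<^sup>2 * (\<sigma>/2 * (norm (adjoint A d))\<^sup>2 + \<sigma>/2 * (d \<bullet> Sy d))" for d t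
      unfolding g_def res shift norm_sq_line psd_form_line[OF Sy] rh_def[symmetric]
      by (simp add: inner_add_left inner_add_right AA algebra_simps)
  qed

  have c: "1 + \<sigma> * lam > 0" using pos by (simp add: add_pos_pos)
  define r where "r = dual_res Q c A y w zb"
  define \<beta> where "\<beta> = \<sigma> / (1 + \<sigma> * lam)"
  have res_y: "dual_res Q c A yb w' zb = dual_res Q c A y w' zb + adjoint A (yb - y)" for w'
    by (simp add: dual_res_def linear_diff[OF Al])
  have res_w: "dual_res Q c A y' wb zb = dual_res Q c A y' w' zb - Q (wb - w')" for y' w'
    by (simp add: dual_res_def linear_diff[OF Ql])
  have "wb - wh = \<beta> *\<^sub>R adjoint A (yb - y)"
    unfolding wb wh_def res_y \<beta>_def by (simp add: algebra_simps)
  then have rh: "rh = rb + \<beta> *\<^sub>R Q (adjoint A (yb - y))"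
    using res_w[of yb wh] by (simp add: rh_def rb_def linear_scale[OF Ql])
  have w_eq: "Q wb - Q xb = \<sigma> *\<^sub>R Q rb - \<sigma> *\<^sub>R Q (lam *\<^sub>R (wb - w) - Q (wb - w))"
  proof -
    have "(1 + \<sigma> * lam) *\<^sub>R wb = (\<sigma> * lam) *\<^sub>R w + xb + \<sigma> *\<^sub>R dual_res Q c A yb w zb"
      using c by (subst wb) simp
    moreover have "dual_res Q c A yb w zb = rb + Q (wb - w)"
      using res_w[of yb w] by (simp add: rb_def)
    ultimately have "wb - xb = \<sigma> *\<^sub>R rb - \<sigma> *\<^sub>R (lam *\<^sub>R (wb - w) - Q (wb - w))"
      by (simp add: algebra_simps)
    then have "Q (wb - xb) = Q (\<sigma> *\<^sub>R rb - \<sigma> *\<^sub>R (lam *\<^sub>R (wb - w) - Q (wb - w)))" by simp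
    then show ?thesis by (simp only: linear_diff[OF Ql] linear_scale[OF Ql])
  qed
  have rb: "\<sigma> *\<^sub>R AQ Q A ((y, w) - (yb, wb)) + (x - xb) = - (\<sigma> *\<^sub>R rb)"
  proof -
    have "rb = r + AQ Q A ((yb, wb) - (y, w))"
      using res_y[of w] res_w[of yb w] by (simp add: rb_def r_def AQ_def)
    moreover have "AQ Q A ((yb, wb) - (y, w)) = - AQ Q A ((y, w) - (yb, wb))"
      by (simp add: AQ_def linear_diff[OF Ql] linear_diff[OF Al])
    ultimately have "r = rb + AQ Q A ((y, w) - (yb, wb))" by simp
    then show ?thesis by (simp add: xb r_def[symmetric] scaleR_add_right)
  qed
  have \<beta>: "\<sigma>\<^sup>2 / (1 + \<sigma> * lam) = \<sigma> * \<beta>" by (simp add: \<beta>_def power2_eq_square)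
  define v where "v = M_op Q A \<sigma> Sy (\<lambda>v. Q (lam *\<^sub>R v - Q v)) (u k - ub (Suc k))"
  define vy vw where "vy = - (A (\<sigma> *\<^sub>R rb)) + \<sigma> *\<^sub>R Sy (y - yb) + (\<sigma> * \<beta>) *\<^sub>R A (Q (adjoint A (y - yb)))"
    and "vw = Q (\<sigma> *\<^sub>R rb) + \<sigma> *\<^sub>R Q (lam *\<^sub>R (w - wb) - Q (w - wb))"
  have "v = ((vy, vw), 0, - rb)"
  proof -
    have d: "u k - ub (Suc k) = ((y, w) - (yb, wb), z - zb, x - xb)" by (simp add: uk ubk)
    show ?thesis
      unfolding v_def M_op_eq_prox_metric[OF Ql A pos(1)] prox_metric_def d prod.case rb
        adjoint_AQ[OF Q A] S_sGS_eq[OF Q A pos] S_op_def \<beta> vy_def vw_def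
      using pos by (simp add: linear_neg[OF A] linear_neg[OF Ql])
  qed
  moreover have "A xb - vy \<in> subdiff (conjugate (indicator_fun K)) (- yb)"
  proof -
    have "A xb - vy = A xb + \<sigma> *\<^sub>R A rh + \<sigma> *\<^sub>R Sy (yb - y)"
    proof -
      have "Sy (y - yb) = - Sy (yb - y)"
        by (metis linear_neg[OF psd_op_linear[OF Sy]] minus_diff_eq)
      moreover have "A (Q (adjoint A (y - yb))) = - A (Q (adjoint A (yb - y)))"
        by (metis linear_neg[OF A] linear_neg[OF Ql] linear_neg[OF Al] minus_diff_eq)
      ultimately show ?thesis
        by (simp add: vy_def rh linear_add[OF A] linear_scale[OF A] scaleR_add_right)
    qed
    with y_sub show ?thesis by (simp only:)
  qed
  moreover have "vw = Q wb - Q xb"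
    unfolding vw_def w_eq by (simp add: linear_diff[OF Ql] linear_scale[OF Ql] algebra_simps)
  ultimately have "v \<in> KKT_op Q c \<phi> A K (ub (Suc k))"
    using z_sub by (simp add: ubk KKT_op_def rb_def)
  then show ?thesis by (simp add: v_def)
qed

section \<open>Convergence rates\<close>

theorem theorem2p2:
  fixes Q :: "real^'n::finite \<Rightarrow> real^'n"
    and c :: "real^'n"
    and \<phi> :: "real^'n \<Rightarrow> ereal"
    and A :: "real^'n \<Rightarrow> real^'m::finite"
    and lo up :: "'m \<Rightarrow> ereal"
    and K :: "(real^'m) set"
    and ys :: "real^'m" and ws zs xs :: "real^'n"
    and \<sigma> lamQ R0 :: real
    and Sy :: "real^'m \<Rightarrow> real^'m"
    and Sw :: "real^'n \<Rightarrow> real^'n"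
    and u ub :: "nat \<Rightarrow> ('m, 'n) point"
    and h :: "real^'m \<Rightarrow> real^'n \<Rightarrow> real^'n \<Rightarrow> ereal"
    and yb :: "nat \<Rightarrow> real^'m" and wb zb xb :: "nat \<Rightarrow> real^'n"
    and k :: nat
  assumes "psd_op Q"
    and "proper_fun \<phi>" and "closed_fun \<phi>" and "convex_fun \<phi>"
    and "linear A"
    and "K = box_set lo up"
    and "is_KKT Q c \<phi> A K ((ys, ws), zs, xs)"
    and "\<sigma> > 0"
    and "lamQ > 0" and "lamQ \<ge> largest_eigenvalue Q"
    and "Sw = (\<lambda>v. Q (lamQ *\<^sub>R v - Q v))"
    and "psd_op Sy" and "pd_op (\<lambda>y. Sy y + A (adjoint A y))"
    and "algorithm_B Q c \<phi> A K \<sigma> lamQ Sy u ub"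
    and "\<And>j. ub j = ((yb j, wb j), zb j, xb j)"
    and "R0 = seminorm (M_op Q A \<sigma> Sy Sw) (u 0 - ((ys, ws), zs, xs))"
    and "h = (\<lambda>y w z. dual_obj Q \<phi> K y w z - dual_obj Q \<phi> K ys ws zs)"
  shows "seminorm (M_op Q A \<sigma> Sy Sw) (ub (Suc k) - u k) \<le> R0 / (real k + 1)
    \<and> norm (KKT_residual Q c \<phi> A K (ub (Suc k)))
        \<le> ((\<sigma> * onorm (adjoint (AQ Q A)) + 1) / sqrt \<sigma>
            + onorm (op_sqrt (\<lambda>p. S_op \<sigma> Sy Sw p + S_sGS Q A \<sigma> Sw p)))
           * (R0 / (real k + 1))
    \<and> ereal (- (norm xs / sqrt \<sigma>) * (R0 / (real k + 1)))
        \<le> h (yb (Suc k)) (wb (Suc k)) (zb (Suc k))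
    \<and> h (yb (Suc k)) (wb (Suc k)) (zb (Suc k))
        \<le> ereal ((3 * R0 + norm xs / sqrt \<sigma>) * (R0 / (real k + 1)))"
proof -
  note Q = assms(1) and \<phi> = assms(2-4) and A = assms(5) and KKT = assms(7) and \<sigma> = assms(8)
    and lam = assms(9) and Sw = assms(11) and Sy = assms(12) and alg = assms(14)
    and ub = assms(15) and R0 = assms(16) and h = assms(17)
  define us where "us = ((ys, ws), zs, xs)"
  define S where "S = (\<lambda>p. S_op \<sigma> Sy Sw p + S_sGS Q A \<sigma> Sw p)"
  define M where "M = M_op Q A \<sigma> Sy Sw"
  define T where "T = KKT_op Q c \<phi> A K"
  note B = linear_AQ[OF psd_op_linear[OF Q] A]
  have S: "psd_op S"
    unfolding S_def Sw by (rule psd_S_plus_sGS[OF Q A Sy \<sigma> lam assms(10)])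
  have M_eq: "M = prox_metric (AQ Q A) S \<sigma>"
    unfolding M_def S_def by (rule M_op_eq_prox_metric[OF psd_op_linear[OF Q] A \<sigma>])
  have M: "psd_op M" unfolding M_eq by (rule psd_prox_metric[OF B S \<sigma>])
  have incl: "M (u j - ub (Suc j)) \<in> T (ub (Suc j))" for j
    unfolding M_def T_def Sw
    by (rule algorithm_B_step[OF Q \<phi>(1) A KKT \<sigma> lam Sy alg])
  have zero: "0 \<in> T us"
    unfolding T_def us_def by (rule zero_in_KKT_op[OF KKT])
  note mono = KKT_op_monotone[OF Q A, of _ c \<phi> K, folded T_def]
  have Halpern_step: "u (Suc j) = (1 / (real j + 2)) *\<^sub>R u 0
      + ((real j + 1) / (real j + 2)) *\<^sub>R (2 *\<^sub>R ub (Suc j) - u j)" for j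
    using alg[unfolded algorithm_B_def, THEN spec[of _ j]]
    by (simp add: Let_def case_prod_beta)
  define N where "N = seminorm M (ub (Suc k) - u k)"
  have sol: "0 \<le> (ub (Suc j) - us) \<bullet> M (u j - ub (Suc j))" for j
    using mono[OF incl[of j] zero] by simp
  note rate = Halpern_rate[OF M Halpern_step mono[OF incl incl] sol]
  have R0M: "R0 = seminorm M (u 0 - us)" by (simp add: R0 M_def us_def)
  have N: "N \<le> R0 / (real k + 1)" unfolding N_def R0M by (rule rate(1))
  have near: "seminorm M (ub (Suc k) - us) \<le> R0" unfolding R0M by (rule rate(2))
  have N0: "0 \<le> N" and R00: "0 \<le> R0" by (simp_all add: N_def R0M seminorm_nonneg[OF M])
  define v where "v = M (u k - ub (Suc k))"
  have v: "v \<in> T (ub (Suc k))" unfolding v_def by (rule incl)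
  have N': "seminorm M (u k - ub (Suc k)) = N"
    unfolding N_def by (rule seminorm_minus[OF M])

  define C where "C = (\<sigma> * onorm (adjoint (AQ Q A)) + 1) / sqrt \<sigma> + onorm (op_sqrt S)"
  have "norm (KKT_residual Q c \<phi> A K (ub (Suc k))) \<le> norm v"
    using closed_convex_box_set[of lo up] v unfolding T_def
    by (intro norm_KKT_residual_le[OF \<phi>]) (simp_all add: assms(6))
  also have "\<dots> \<le> C * N"
    using norm_prox_metric_le[OF B S \<sigma>, of "u k - ub (Suc k)"]
    by (simp add: v_def M_eq[symmetric] N' C_def)
  also have "\<dots> \<le> C * (R0 / (real k + 1))"
  proof (rule mult_left_mono[OF N])
    show "0 \<le> C"
      unfolding C_def using adjoint_linear[OF B] op_sqrt(1)[OF S] \<sigma>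
      by (intro add_nonneg_nonneg divide_nonneg_nonneg mult_nonneg_nonneg onorm_pos_le)
        (auto simp: psd_op_def linear_conv_bounded_linear)
  qed
  finally have residual: "norm (KKT_residual Q c \<phi> A K (ub (Suc k))) \<le> C * (R0 / (real k + 1))" .

  let ?f = "dual_obj Q \<phi> K (yb (Suc k)) (wb (Suc k)) (zb (Suc k))" and ?fs = "dual_obj Q \<phi> K ys ws zs"
  define r where "r = dual_res Q c A (yb (Suc k)) (wb (Suc k)) (zb (Suc k))"
  have rs: "dual_res Q c A ys ws zs = 0" using KKT unfolding is_KKT_def dual_res_def prod.case by blast
  obtain f where f: "?f = ereal f"
    using dual_obj_finite v unfolding T_def ub by blast
  obtain fs where fs: "?fs = ereal fs"
    using dual_obj_finite zero unfolding T_def us_def by blast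
  have r_le: "\<bar>xs \<bullet> r\<bar> \<le> norm xs / sqrt \<sigma> * (R0 / (real k + 1))"
  proof -
    have "snd (snd v) = - r" using v by (auto simp: T_def ub KKT_op_def r_def)
    then have "norm r \<le> N / sqrt \<sigma>"
      using norm_prox_metric_multiplier_le[OF B S \<sigma>, of "u k - ub (Suc k)"]
      by (simp add: v_def M_eq[symmetric] N')
    also have "\<dots> \<le> R0 / (real k + 1) / sqrt \<sigma>" using N \<sigma> by (intro divide_right_mono) auto
    finally have "norm xs * norm r \<le> norm xs * (R0 / (real k + 1) / sqrt \<sigma>)"
      by (rule mult_left_mono) simp
    then show ?thesis using Cauchy_Schwarz_ineq2[of xs r] by (simp add: mult.commute)
  qed
  have "ereal (fs - xs \<bullet> r) \<le> ?f"
    using dual_obj_ge[OF Q A zero[unfolded T_def us_def],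
        of "yb (Suc k)" "wb (Suc k)" "zb (Suc k)" "xb (Suc k)"]
    by (simp add: rs r_def fs)
  then have lower: "- (norm xs / sqrt \<sigma> * (R0 / (real k + 1))) \<le> f - fs"
    using r_le by (simp add: f)
  have "f + (v \<bullet> (us - ub (Suc k)) + xs \<bullet> r) \<le> fs"
    using dual_obj_ge[OF Q A v[unfolded T_def ub], of ys ws zs xs]
    by (simp add: rs r_def[symmetric] f fs us_def ub)
  \<comment> \<open>One \<open>R0\<close> suffices in the first factor: \<open>ub (Suc k)\<close> is no farther from the solution than \<open>u 0\<close>.\<close>
  moreover have "- (v \<bullet> (us - ub (Suc k))) \<le> R0 * (R0 / (real k + 1))"
  proof -
    have "us - ub (Suc k) = - (ub (Suc k) - us)" by simp
    then have "- (v \<bullet> (us - ub (Suc k))) = v \<bullet> (ub (Suc k) - us)"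
      by (simp only: inner_minus_right minus_minus)
    also have "\<dots> = (ub (Suc k) - us) \<bullet> M (u k - ub (Suc k))"
      unfolding v_def by (rule inner_commute)
    also have "\<dots> \<le> seminorm M (ub (Suc k) - us) * N"
      using psd_inner_le_seminorm[OF M] by (metis N')
    also have "\<dots> \<le> R0 * (R0 / (real k + 1))"
      by (rule mult_mono[OF near N R00 N0])
    finally show ?thesis .
  qed
  moreover have "0 \<le> R0 * (R0 / (real k + 1))" using R00 by simp
  ultimately have upper: "f - fs \<le> (3 * R0 + norm xs / sqrt \<sigma>) * (R0 / (real k + 1))"
    using r_le unfolding distrib_right mult.assoc[of 3] by linarith
  show ?thesis
    using N residual lower upper
    unfolding N_def M_def C_def S_def by (simp add: h f fs)
qed

end
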